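(* Let $A,B$ be sets, $L\colon A^*\rightharpoonup B^*$ a partial function (regarded as an element of $(B^*+1)^{A^*}$), and $\mathcal{L}_{\mathsf{Kl}(\mathcal{T})}\colon\mathcal{O}_{\mathsf{word}}\to\mathsf{Kl}(\mathcal{T})$ the corresponding $(\mathsf{Kl}(\mathcal{T}),1,1)$-language. Let $\mathcal{A}^{\mathit{final}}(\mathcal{L}_{\mathsf{Kl}(\mathcal{T})})\colon\mathcal{I}_{\mathsf{word}}\to\mathsf{Kl}(\mathcal{T})$ be the automaton sending $\mathsf{in}$ and $\mathsf{out}$ to $1$, $\mathsf{states}$ to $\mathsf{Irr}(A^*,B^* )$, and defined on generating arrows by - $\triangleright\mapsto\big(1\nrightarrow\mathsf{Irr}(A^*,B^* )\big)$, $0\mapsto(\mathsf{lcp}(L),\mathsf{red}(L))$ if $L\neq\kappa_\bot$, and $0\mapsto\bot$ if $L=\kappa_\bot$; - $\triangleleft\mapsto\big(\mathsf{Irr}(A^*,B^* )\nrightarrow 1\big)$, $K\mapsto K(\varepsilon)$; - for $a\in A$, $a\mapsto\big(\mathsf{Irr}(A^*,B^* )\nrightarrow\mathsf{Irr}(A^*,B^* )\big)$, $K\mapsto\bot$ if $a^{-1}K=\kappa_\bot$, and $K\mapsto(\mathsf{lcp}(a^{-1}K),\mathsf{red}(a^{-1}K))$ otherwise. Then $\mathcal{A}^{\mathit{final}}(\mathcal{L}_{\mathsf{Kl}(\mathcal{T})})$ is a final object of $\mathsf{Auto}(\mathcal{L}_{\mathsf{Kl}(\mathcal{T})})$.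
   Context: The category $\mathcal{I}_{\mathsf{word}}$ has objects $\mathsf{in},\mathsf{states},\mathsf{out}$ and is freely generated by arrows $\triangleright\colon\mathsf{in}\to\mathsf{states}$, $a\colon\mathsf{states}\to\mathsf{states}$ ($a\in A$), $\triangleleft\colon\mathsf{states}\to\mathsf{out}$; composition is written left to right as concatenation, so the arrows $\mathsf{in}\to\mathsf{out}$ are the $\triangleright w\triangleleft$ with $w\in A^*$. $\mathcal{O}_{\mathsf{word}}$ is the full subcategory on $\mathsf{in},\mathsf{out}$, with inclusion $\iota$. $\mathcal{T}$ is the monad $\mathcal{T}X=B^*\times X+1$ on $\mathsf{Set}$ (with $\bot$ the element of the summand $1$), unit $x\mapsto(\varepsilon,x)$ and multiplication $(w,(u,x))\mapsto(wu,x)$, $(w,\bot)\mapsto\bot$, $\bot\mapsto\bot$. $\mathsf{Kl}(\mathcal{T})$ is its Kleisli category; a morphism $f\colon X\nrightarrow Y$ is a function $X\to B^*\times Y+1$. Let $1=\{0\}$; $\mathcal{T}1$ is identified with $B^*+1$. The language $\mathcal{L}_{\mathsf{Kl}(\mathcal{T})}$ sends $\mathsf{in},\mathsf{out}$ to $1$ and $\triangleright w\triangleleft$ to $L(w)\colon1\nrightarrow1$ (with $L(w)=\bot$ if undefined). $\mathsf{Auto}(\mathcal{L})$ is the category of functors $\mathcal{A}\colon\mathcal{I}_{\mathsf{word}}\to\mathsf{Kl}(\mathcal{T})$ with $\mathcal{A}\circ\iota=\mathcal{L}$, with arrows the natural transformations $\alpha$ with $\alpha\circ\iota=\mathrm{id}_{\mathcal{L}}$.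 $\kappa_\bot\in(B^*+1)^{A^*}$ is the constant function with value $\bot$. For $K\neq\kappa_\bot$ in $(B^*+1)^{A^*}$: $\mathsf{lcp}(K)\in B^*$ is the longest word that is a prefix of all $K(u)\neq\bot$, $u\in A^*$; $\mathsf{red}(K)\in(B^*+1)^{A^*}$ is defined by $\mathsf{red}(K)(u)=v$ if $K(u)=\mathsf{lcp}(K)\,v$ and $\mathsf{red}(K)(u)=\bot$ otherwise; $K$ is irreducible if $\mathsf{lcp}(K)=\varepsilon$. $\mathsf{Irr}(A^*,B^* )$ is the set of irreducible functions (in particular $\kappa_\bot\notin\mathsf{Irr}(A^*,B^* )$). For $a\in A$, $a^{-1}K$ is the function $w\mapsto K(aw)$. *)

theory Defs
  imports "HOL-Library.FuncSet" "HOL-Library.Sublist"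
begin

section \<open>Categories, functors, natural transformations\<close>

text \<open>Composition is in diagrammatic order: \<open>Comp C f g\<close> is ``first \<open>f\<close>, then \<open>g\<close>''.\<close>

record ('o, 'm) category =
  Obj :: "'o set"
  Arr :: "'m set"
  Dom :: "'m \<Rightarrow> 'o"
  Cod :: "'m \<Rightarrow> 'o"
  Ident :: "'o \<Rightarrow> 'm"
  Comp :: "'m \<Rightarrow> 'm \<Rightarrow> 'm"

definition Hom :: "('o, 'm) category \<Rightarrow> 'o \<Rightarrow> 'o \<Rightarrow> 'm set" where
  "Hom C x y = {f \<in> Arr C. Dom C f = x \<and> Cod C f = y}"

definition is_category :: "('o, 'm) category \<Rightarrow> bool" where
  "is_category C \<longleftrightarrow>
     (\<forall>f\<in>Arr C. Dom C f \<in> Obj C \<and> Cod C f \<in> Obj C) \<and>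
     (\<forall>x\<in>Obj C. Ident C x \<in> Hom C x x) \<and>
     (\<forall>f\<in>Arr C. \<forall>g\<in>Arr C. Cod C f = Dom C g \<longrightarrow> Comp C f g \<in> Hom C (Dom C f) (Cod C g)) \<and>
     (\<forall>f\<in>Arr C. Comp C (Ident C (Dom C f)) f = f \<and> Comp C f (Ident C (Cod C f)) = f) \<and>
     (\<forall>f\<in>Arr C. \<forall>g\<in>Arr C. \<forall>h\<in>Arr C. Cod C f = Dom C g \<longrightarrow> Cod C g = Dom C h \<longrightarrow>
        Comp C (Comp C f g) h = Comp C f (Comp C g h))"

definition final_object :: "('o, 'm) category \<Rightarrow> 'o \<Rightarrow> bool" where
  "final_object C t \<longleftrightarrow> t \<in> Obj C \<and> (\<forall>x\<in>Obj C. \<exists>!f. f \<in> Hom C x t)"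

definition full_subcategory :: "('o, 'm) category \<Rightarrow> 'o set \<Rightarrow> ('o, 'm) category" where
  "full_subcategory C S =
     C\<lparr>Obj := Obj C \<inter> S, Arr := {f \<in> Arr C. Dom C f \<in> S \<and> Cod C f \<in> S}\<rparr>"

text \<open>Object and arrow maps of functors, and families of components of natural
  transformations, are extensional (\<open>undefined\<close> off their domain), so that HOL equality
  is equality of functors and of natural transformations.\<close>

record ('o, 'm, 'p, 'n) funct =
  ObjMap :: "'o \<Rightarrow> 'p"
  ArrMap :: "'m \<Rightarrow> 'n"

definition is_functor ::
    "('o, 'm) category \<Rightarrow> ('p, 'n) category \<Rightarrow> ('o, 'm, 'p, 'n) funct \<Rightarrow> bool" where
  "is_functor C D F \<longleftrightarrow>
     ObjMap F \<in> Obj C \<rightarrow>\<^sub>E Obj D \<and>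
     ArrMap F \<in> Arr C \<rightarrow>\<^sub>E Arr D \<and>
     (\<forall>f\<in>Arr C. Dom D (ArrMap F f) = ObjMap F (Dom C f) \<and>
                Cod D (ArrMap F f) = ObjMap F (Cod C f)) \<and>
     (\<forall>x\<in>Obj C. ArrMap F (Ident C x) = Ident D (ObjMap F x)) \<and>
     (\<forall>f\<in>Arr C. \<forall>g\<in>Arr C. Cod C f = Dom C g \<longrightarrow>
        ArrMap F (Comp C f g) = Comp D (ArrMap F f) (ArrMap F g))"

definition inclusion :: "('o, 'm) category \<Rightarrow> ('o, 'm, 'o, 'm) funct" where
  "inclusion C = \<lparr>ObjMap = (\<lambda>x\<in>Obj C. x), ArrMap = (\<lambda>f\<in>Arr C. f)\<rparr>"

text \<open>\<open>functor_comp C F G\<close> is ``\<open>G\<close> after \<open>F\<close>'', where \<open>C\<close> is the domain of \<open>F\<close>.\<close>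

definition functor_comp ::
    "('o, 'm) category \<Rightarrow> ('o, 'm, 'p, 'n) funct \<Rightarrow> ('p, 'n, 'q, 'k) funct \<Rightarrow> ('o, 'm, 'q, 'k) funct" where
  "functor_comp C F G =
     \<lparr>ObjMap = (\<lambda>x\<in>Obj C. ObjMap G (ObjMap F x)), ArrMap = (\<lambda>f\<in>Arr C. ArrMap G (ArrMap F f))\<rparr>"

definition is_nat_trans ::
    "('o, 'm) category \<Rightarrow> ('p, 'n) category \<Rightarrow> ('o, 'm, 'p, 'n) funct \<Rightarrow> ('o, 'm, 'p, 'n) funct
     \<Rightarrow> ('o \<Rightarrow> 'n) \<Rightarrow> bool" where
  "is_nat_trans C D F G \<alpha> \<longleftrightarrow>
     \<alpha> \<in> (\<Pi>\<^sub>E x\<in>Obj C. Hom D (ObjMap F x) (ObjMap G x)) \<and>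
     (\<forall>f\<in>Arr C. Comp D (ArrMap F f) (\<alpha> (Cod C f)) = Comp D (\<alpha> (Dom C f)) (ArrMap G f))"

definition id_nat_trans ::
    "('o, 'm) category \<Rightarrow> ('p, 'n) category \<Rightarrow> ('o, 'm, 'p, 'n) funct \<Rightarrow> 'o \<Rightarrow> 'n" where
  "id_nat_trans C D F = (\<lambda>x\<in>Obj C. Ident D (ObjMap F x))"

text \<open>Whiskering of \<open>\<alpha>\<close> with a functor \<open>H\<close> whose domain is \<open>C\<close>.\<close>

definition whisker :: "('o, 'm) category \<Rightarrow> ('o, 'm, 'p, 'n) funct \<Rightarrow> ('p \<Rightarrow> 'k) \<Rightarrow> 'o \<Rightarrow> 'k" where
  "whisker C H \<alpha> = (\<lambda>x\<in>Obj C. \<alpha> (ObjMap H x))"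

text \<open>Arrows that carry their source and target explicitly.\<close>

datatype ('o, 'f) arrow = Arrow (src: 'o) (body: 'f) (tgt: 'o)

section \<open>Free category on a graph\<close>

fun is_path :: "'e set \<Rightarrow> ('e \<Rightarrow> 'v) \<Rightarrow> ('e \<Rightarrow> 'v) \<Rightarrow> 'v \<Rightarrow> 'e list \<Rightarrow> 'v \<Rightarrow> bool" where
  "is_path E s t x [] y \<longleftrightarrow> x = y"
| "is_path E s t x (e # es) y \<longleftrightarrow> e \<in> E \<and> s e = x \<and> is_path E s t (t e) es y"

definition free_category ::
    "'v set \<Rightarrow> 'e set \<Rightarrow> ('e \<Rightarrow> 'v) \<Rightarrow> ('e \<Rightarrow> 'v) \<Rightarrow> ('v, ('v, 'e list) arrow) category" where
  "free_category V E s t =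
     \<lparr>Obj = V,
      Arr = {Arrow x p y | x p y. x \<in> V \<and> y \<in> V \<and> is_path E s t x p y},
      Dom = src, Cod = tgt,
      Ident = (\<lambda>x. Arrow x [] x),
      Comp = (\<lambda>f g. Arrow (src f) (body f @ body g) (tgt g))\<rparr>"

text \<open>The extension to paths of an assignment \<open>fo\<close> on vertices and \<open>fe\<close> on edges.\<close>

fun path_ext ::
    "('e \<Rightarrow> 'v) \<Rightarrow> ('p, 'n) category \<Rightarrow> ('v \<Rightarrow> 'p) \<Rightarrow> ('e \<Rightarrow> 'n) \<Rightarrow> 'v \<Rightarrow> 'e list \<Rightarrow> 'n" where
  "path_ext t D fo fe x [] = Ident D (fo x)"
| "path_ext t D fo fe x (e # es) = Comp D (fe e) (path_ext t D fo fe (t e) es)"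

definition free_extension ::
    "'v set \<Rightarrow> 'e set \<Rightarrow> ('e \<Rightarrow> 'v) \<Rightarrow> ('e \<Rightarrow> 'v) \<Rightarrow> ('p, 'n) category \<Rightarrow> ('v \<Rightarrow> 'p) \<Rightarrow> ('e \<Rightarrow> 'n)
     \<Rightarrow> ('v, ('v, 'e list) arrow, 'p, 'n) funct" where
  "free_extension V E s t D fo fe =
     \<lparr>ObjMap = (\<lambda>x\<in>V. fo x),
      ArrMap = (\<lambda>f\<in>Arr (free_category V E s t). path_ext t D fo fe (src f) (body f))\<rparr>"

section \<open>The input categories, languages and automata\<close>

datatype word_obj = In | States | Out

datatype 'a word_gen = Start | Letter 'a | Finish

fun gen_src :: "'a word_gen \<Rightarrow> word_obj" where
  "gen_src Start = In"
| "gen_src (Letter a) = States"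
| "gen_src Finish = States"

fun gen_tgt :: "'a word_gen \<Rightarrow> word_obj" where
  "gen_tgt Start = States"
| "gen_tgt (Letter a) = States"
| "gen_tgt Finish = Out"

definition word_gens :: "'a set \<Rightarrow> 'a word_gen set" where
  "word_gens A = {Start, Finish} \<union> Letter ` A"

type_synonym 'a word_arrow = "(word_obj, 'a word_gen list) arrow"

definition I_word :: "'a set \<Rightarrow> (word_obj, 'a word_arrow) category" where
  "I_word A = free_category UNIV (word_gens A) gen_src gen_tgt"

definition O_word :: "'a set \<Rightarrow> (word_obj, 'a word_arrow) category" where
  "O_word A = full_subcategory (I_word A) {In, Out}"

text \<open>The arrow from \<open>In\<close> to \<open>Out\<close> given by the word \<open>w\<close>.\<close>

definition word_arrow :: "'a list \<Rightarrow> 'a word_arrow" where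
  "word_arrow w = Arrow In (Start # map Letter w @ [Finish]) Out"

text \<open>The category of \<open>D\<close>-valued automata accepting the language \<open>\<L>\<close>.\<close>

definition Auto ::
    "'a set \<Rightarrow> ('p, 'n) category \<Rightarrow> (word_obj, 'a word_arrow, 'p, 'n) funct
     \<Rightarrow> ((word_obj, 'a word_arrow, 'p, 'n) funct,
         ((word_obj, 'a word_arrow, 'p, 'n) funct, word_obj \<Rightarrow> 'n) arrow) category" where
  "Auto A D \<L> =
    (let obs = {F. is_functor (I_word A) D F \<and>
                   functor_comp (O_word A) (inclusion (O_word A)) F = \<L>}
     in \<lparr>Obj = obs,
         Arr = {Arrow F \<alpha> G | F \<alpha> G. F \<in> obs \<and> G \<in> obs \<and>
                  is_nat_trans (I_word A) D F G \<alpha> \<and>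
                  whisker (O_word A) (inclusion (O_word A)) \<alpha> = id_nat_trans (O_word A) D \<L>},
         Dom = src, Cod = tgt,
         Ident = (\<lambda>F. Arrow F (id_nat_trans (I_word A) D F) F),
         Comp = (\<lambda>f g. Arrow (src f)
                   (\<lambda>x\<in>Obj (I_word A). Comp D (body f x) (body g x)) (tgt g))\<rparr>)"

section \<open>The Kleisli category\<close>

text \<open>An element of \<open>B\<^sup>* \<times> X + 1\<close> is an option, with \<open>\<bottom>\<close> rendered as \<open>None\<close>.\<close>

definition T_obj :: "'b set \<Rightarrow> 'u set \<Rightarrow> ('b list \<times> 'u) option set" where
  "T_obj B X = insert None (Some ` (lists B \<times> X))"

definition T_map :: "('u \<Rightarrow> 'v) \<Rightarrow> ('b list \<times> 'u) option \<Rightarrow> ('b list \<times> 'v) option" where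
  "T_map h = map_option (\<lambda>(w, x). (w, h x))"

definition T_unit :: "'u \<Rightarrow> ('b list \<times> 'u) option" where
  "T_unit x = Some ([], x)"

fun T_mult :: "('b list \<times> ('b list \<times> 'u) option) option \<Rightarrow> ('b list \<times> 'u) option" where
  "T_mult (Some (w, Some (u, x))) = Some (w @ u, x)"
| "T_mult (Some (w, None)) = None"
| "T_mult None = None"

type_synonym ('b, 'u) kl_arrow = "('u set, 'u \<Rightarrow> ('b list \<times> 'u) option) arrow"

text \<open>The objects are all sets of elements of a universe type \<open>'u\<close>.\<close>

definition Kl :: "'b set \<Rightarrow> ('u set, ('b, 'u) kl_arrow) category" where
  "Kl B =
     \<lparr>Obj = UNIV,
      Arr = {Arrow X f Y | X f Y. f \<in> X \<rightarrow>\<^sub>E T_obj B Y},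
      Dom = src, Cod = tgt,
      Ident = (\<lambda>X. Arrow X (\<lambda>x\<in>X. T_unit x) X),
      Comp = (\<lambda>f g. Arrow (src f) (\<lambda>x\<in>src f. T_mult (T_map (body g) (body f x))) (tgt g))\<rparr>"

section \<open>Irreducible partial functions\<close>

text \<open>\<open>(B\<^sup>* + 1)\<^sup>A\<^sup>*\<close>, identified with the partial functions from words over \<open>A\<close> to words over
  \<open>B\<close>: a value \<open>\<bottom>\<close> is rendered as \<open>None\<close>, which is also the value on lists that are not
  words over \<open>A\<close>. Hence \<open>\<kappa>\<^sub>\<bottom>\<close> is \<open>Map.empty\<close>.\<close>

definition word_funs :: "'a set \<Rightarrow> 'b set \<Rightarrow> ('a list \<rightharpoonup> 'b list) set" where
  "word_funs A B = {K. dom K \<subseteq> lists A \<and> ran K \<subseteq> lists B}"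

text \<open>Meaningful for \<open>K \<noteq> Map.empty\<close> only.\<close>

definition lcp :: "('a list \<rightharpoonup> 'b list) \<Rightarrow> 'b list" where
  "lcp K = Longest_common_prefix (ran K)"

definition red :: "('a list \<rightharpoonup> 'b list) \<Rightarrow> ('a list \<rightharpoonup> 'b list)" where
  "red K = (\<lambda>u. if \<exists>v. K u = Some (lcp K @ v) then Some (THE v. K u = Some (lcp K @ v)) else None)"

definition Irr :: "'a set \<Rightarrow> 'b set \<Rightarrow> ('a list \<rightharpoonup> 'b list) set" where
  "Irr A B = {K \<in> word_funs A B. K \<noteq> Map.empty \<and> lcp K = []}"

definition left_quotient :: "'a \<Rightarrow> ('a list \<rightharpoonup> 'b list) \<Rightarrow> ('a list \<rightharpoonup> 'b list)" where
  "left_quotient a K = (\<lambda>w. K (a # w))"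

section \<open>The language in the Kleisli category and the final automaton\<close>

text \<open>The universe of elements: the point of the singleton \<open>1 = {0}\<close>, the partial functions
  that occur as states of the final automaton, and a copy of a type \<open>'x\<close>. Since \<open>'x\<close> is
  arbitrary, every set is in bijection with an object of the Kleisli category over some
  instance of this universe.\<close>

datatype ('a, 'b, 'x) elem = Zero | Fun (the_fun: "'a list \<rightharpoonup> 'b list") | Other 'x

definition One :: "('a, 'b, 'x) elem set" where
  "One = {Zero}"

text \<open>The identification of \<open>B\<^sup>* + 1\<close> with \<open>\<T>1\<close>.\<close>

definition to_T1 :: "'b list option \<Rightarrow> ('b list \<times> ('a, 'b, 'x) elem) option" where
  "to_T1 = map_option (\<lambda>v. (v, Zero))"

definition language ::
    "'a set \<Rightarrow> 'b set \<Rightarrow> ('a list \<rightharpoonup> 'b list)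
     \<Rightarrow> (word_obj, 'a word_arrow, ('a, 'b, 'x) elem set, ('b, ('a, 'b, 'x) elem) kl_arrow) funct" where
  "language A B L =
     \<lparr>ObjMap = (\<lambda>x\<in>Obj (O_word A). One),
      ArrMap = (\<lambda>f\<in>Arr (O_word A).
        if \<exists>w. f = word_arrow w
        then Arrow One (\<lambda>z\<in>One. to_T1 (L (THE w. f = word_arrow w))) One
        else Ident (Kl B) One)\<rparr>"

definition Irr_states :: "'a set \<Rightarrow> 'b set \<Rightarrow> ('a, 'b, 'x) elem set" where
  "Irr_states A B = Fun ` Irr A B"

definition lcp_red :: "('a list \<rightharpoonup> 'b list) \<Rightarrow> ('b list \<times> ('a, 'b, 'x) elem) option" where
  "lcp_red K = (if K = Map.empty then None else Some (lcp K, Fun (red K)))"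

fun final_objs :: "'a set \<Rightarrow> 'b set \<Rightarrow> word_obj \<Rightarrow> ('a, 'b, 'x) elem set" where
  "final_objs A B In = One"
| "final_objs A B States = Irr_states A B"
| "final_objs A B Out = One"

fun final_gens ::
    "'a set \<Rightarrow> 'b set \<Rightarrow> ('a list \<rightharpoonup> 'b list) \<Rightarrow> 'a word_gen
     \<Rightarrow> ('b, ('a, 'b, 'x) elem) kl_arrow" where
  "final_gens A B L Start = Arrow One (\<lambda>z\<in>One. lcp_red L) (Irr_states A B)"
| "final_gens A B L (Letter a) =
     Arrow (Irr_states A B) (\<lambda>q\<in>Irr_states A B. lcp_red (left_quotient a (the_fun q))) (Irr_states A B)"
| "final_gens A B L Finish =
     Arrow (Irr_states A B) (\<lambda>q\<in>Irr_states A B. to_T1 (the_fun q [])) One"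

definition final_automaton ::
    "'a set \<Rightarrow> 'b set \<Rightarrow> ('a list \<rightharpoonup> 'b list)
     \<Rightarrow> (word_obj, 'a word_arrow, ('a, 'b, 'x) elem set, ('b, ('a, 'b, 'x) elem) kl_arrow) funct" where
  "final_automaton A B L =
     free_extension UNIV (word_gens A) gen_src gen_tgt (Kl B) (final_objs A B) (final_gens A B L)"

section \<open>Well-definedness\<close>

lemma is_path_append:
  "is_path E s t x p y \<Longrightarrow> is_path E s t y q z \<Longrightarrow> is_path E s t x (p @ q) z"
  by (induction p arbitrary: x) auto

lemma category_ident:
  assumes "is_category C" "f \<in> Arr C"
  shows "Comp C (Ident C (Dom C f)) f = f" "Comp C f (Ident C (Cod C f)) = f"
  using assms by (simp_all add: is_category_def)

lemma is_category_free_category: "is_category (free_category V E s t)"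
  by (auto simp: is_category_def free_category_def Hom_def intro: is_path_append)

lemma is_category_I_word: "is_category (I_word A)"
  by (simp add: I_word_def is_category_free_category)

lemma is_category_full_subcategory: "is_category C \<Longrightarrow> is_category (full_subcategory C S)"
  by (auto simp: is_category_def full_subcategory_def Hom_def)

lemma is_category_O_word: "is_category (O_word A)"
  by (simp add: O_word_def is_category_I_word is_category_full_subcategory)

lemma T_mult_in: "m \<in> T_obj B X \<Longrightarrow> h \<in> X \<rightarrow> T_obj B Y \<Longrightarrow> T_mult (T_map h m) \<in> T_obj B Y"
proof (cases m)
  case (Some p)
  assume m: "m \<in> T_obj B X" and h: "h \<in> X \<rightarrow> T_obj B Y"
  from m Some obtain w x where wx: "m = Some (w, x)" "w \<in> lists B" "x \<in> X"
    by (auto simp: T_obj_def)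
  with h have "h x \<in> T_obj B Y" by blast
  with wx show ?thesis by (auto simp: T_obj_def T_map_def image_iff)
qed (simp add: T_map_def T_obj_def)

lemma T_mult_assoc:
  "m \<in> T_obj B X \<Longrightarrow> h \<in> X \<rightarrow> T_obj B Y \<Longrightarrow>
   T_mult (T_map k (T_mult (T_map h m))) =
   T_mult (T_map (\<lambda>x\<in>X. T_mult (T_map k (h x))) m)"
proof (cases m)
  case (Some p)
  moreover assume "m \<in> T_obj B X"
  ultimately obtain w x where m: "m = Some (w, x)" "x \<in> X" by (auto simp: T_obj_def)
  show ?thesis
  proof (cases "h x")
    case (Some q)
    then obtain u y where h: "h x = Some (u, y)" by (cases q) auto
    show ?thesis using m h by (cases "k y") (auto simp: T_map_def)
  qed (use m in \<open>simp add: T_map_def\<close>)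
qed (simp add: T_map_def)

lemma T_mult_unit: "m \<in> T_obj B X \<Longrightarrow> T_mult (T_map (restrict T_unit X) m) = m"
  by (auto simp: T_obj_def T_map_def T_unit_def)

lemma T_mult_map_unit: "T_mult (T_map h (T_unit x)) = h x"
  by (cases "h x") (auto simp: T_map_def T_unit_def)

lemma is_category_Kl: "is_category (Kl B)"
  unfolding is_category_def
proof (intro conjI ballI impI)
  fix f g h :: "('b, 'u) kl_arrow"
  assume f: "f \<in> Arr (Kl B)"
  then obtain X u Y where fe: "f = Arrow X u Y" and u: "u \<in> X \<rightarrow>\<^sub>E T_obj B Y"
    by (auto simp: Kl_def)
  have mem: "u x \<in> T_obj B Y" if "x \<in> X" for x
    using u that by auto
  show "Comp (Kl B) (Ident (Kl B) (Dom (Kl B) f)) f = f"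
    using u by (auto simp: Kl_def fe T_mult_map_unit fun_eq_iff PiE_def extensional_def)
  show "Comp (Kl B) f (Ident (Kl B) (Cod (Kl B) f)) = f"
    using u mem by (auto simp: Kl_def fe T_mult_unit[of _ B] fun_eq_iff PiE_def extensional_def)
  assume g: "g \<in> Arr (Kl B)" and fg: "Cod (Kl B) f = Dom (Kl B) g"
  then obtain v Z where ge: "g = Arrow Y v Z" and v: "v \<in> Y \<rightarrow>\<^sub>E T_obj B Z"
    by (auto simp: Kl_def fe)
  have v': "v \<in> Y \<rightarrow> T_obj B Z" using v by (auto simp: PiE_def)
  show "Comp (Kl B) f g \<in> Hom (Kl B) (Dom (Kl B) f) (Cod (Kl B) g)"
    using mem v' by (auto simp: Kl_def fe ge Hom_def intro: T_mult_in)
  assume h: "h \<in> Arr (Kl B)" and gh: "Cod (Kl B) g = Dom (Kl B) h"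
  then obtain w W where he: "h = Arrow Z w W" by (auto simp: Kl_def ge)
  show "Comp (Kl B) (Comp (Kl B) f g) h = Comp (Kl B) f (Comp (Kl B) g h)"
    using mem v' by (auto simp: Kl_def fe ge he fun_eq_iff T_mult_assoc[of _ B])
qed (auto simp: Kl_def Hom_def T_unit_def T_obj_def)

lemma is_category_Auto:
  assumes D: "is_category D"
  shows "is_category (Auto A D \<L>)"
proof -
  let ?I = "I_word A" and ?C = "Auto A D \<L>" and ?O = "O_word A"
  have I: "is_category ?I" by (rule is_category_I_word)
  have Obj_I: "Obj ?I = UNIV" by (simp add: I_word_def free_category_def)
  have comp_in: "Comp D u v \<in> Hom D x z" if "u \<in> Hom D x y" "v \<in> Hom D y z" for u v x y z
    using D that unfolding is_category_def Hom_def mem_Collect_eq by simp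
  have id_in: "Ident D x \<in> Hom D x x" if "x \<in> Obj D" for x
    using D that unfolding is_category_def by blast
  have id_l: "Comp D (Ident D x) u = u" and id_r: "Comp D u (Ident D y) = u"
    if "u \<in> Hom D x y" for u x y
    using D that unfolding is_category_def Hom_def by auto
  have assoc: "Comp D (Comp D u v) w = Comp D u (Comp D v w)"
    if "u \<in> Hom D x y" "v \<in> Hom D y z" "w \<in> Hom D z z'" for u v w x y z z'
    using D that unfolding is_category_def Hom_def mem_Collect_eq by simp
  have F_ob: "ObjMap F x \<in> Obj D" if "is_functor ?I D F" for F x
    using that by (auto simp: is_functor_def Obj_I)
  have F_hom: "ArrMap F f \<in> Hom D (ObjMap F (Dom ?I f)) (ObjMap F (Cod ?I f))"
    if "is_functor ?I D F" "f \<in> Arr ?I" for F f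
    using that by (auto simp: is_functor_def Hom_def)
  have nat_comp: "is_nat_trans ?I D F H (\<lambda>x. Comp D (\<alpha> x) (\<beta> x))"
    if F: "is_functor ?I D F" and G: "is_functor ?I D G" and H: "is_functor ?I D H"
      and \<alpha>: "is_nat_trans ?I D F G \<alpha>" and \<beta>: "is_nat_trans ?I D G H \<beta>" for F G H \<alpha> \<beta>
  proof -
    have a: "\<alpha> x \<in> Hom D (ObjMap F x) (ObjMap G x)" for x
      using \<alpha> by (auto simp: is_nat_trans_def Obj_I PiE_def)
    have b: "\<beta> x \<in> Hom D (ObjMap G x) (ObjMap H x)" for x
      using \<beta> by (auto simp: is_nat_trans_def Obj_I PiE_def)
    have "Comp D (ArrMap F f) (Comp D (\<alpha> (Cod ?I f)) (\<beta> (Cod ?I f))) =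
          Comp D (Comp D (\<alpha> (Dom ?I f)) (\<beta> (Dom ?I f))) (ArrMap H f)" if f: "f \<in> Arr ?I" for f
    proof -
      have n1: "Comp D (ArrMap F f) (\<alpha> (Cod ?I f)) = Comp D (\<alpha> (Dom ?I f)) (ArrMap G f)"
        using \<alpha> f by (auto simp: is_nat_trans_def)
      have n2: "Comp D (ArrMap G f) (\<beta> (Cod ?I f)) = Comp D (\<beta> (Dom ?I f)) (ArrMap H f)"
        using \<beta> f by (auto simp: is_nat_trans_def)
      show ?thesis
        using assoc[OF F_hom[OF F f] a b] assoc[OF a F_hom[OF G f] b]
          assoc[OF a b F_hom[OF H f]] n1 n2 by simp
    qed
    then show ?thesis using comp_in[OF a b] by (auto simp: is_nat_trans_def Obj_I)
  qed
  have nat_id: "is_nat_trans ?I D F F (id_nat_trans ?I D F)" if F: "is_functor ?I D F" for F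
    using id_in[OF F_ob[OF F]] id_l[OF F_hom[OF F]] id_r[OF F_hom[OF F]]
    by (auto simp: is_nat_trans_def id_nat_trans_def Obj_I)
  have whisk: "whisker ?O (inclusion ?O) \<alpha> = id_nat_trans ?O D \<L> \<longleftrightarrow>
      (\<forall>x\<in>Obj ?O. \<alpha> x = Ident D (ObjMap F x))"
    if "functor_comp ?O (inclusion ?O) F = \<L>" for \<alpha> F
    using that by (auto simp: whisker_def id_nat_trans_def functor_comp_def inclusion_def
        fun_eq_iff restrict_def)
  have obD: "is_functor ?I D F" "functor_comp ?O (inclusion ?O) F = \<L>" if "F \<in> Obj ?C" for F
    using that by (auto simp: Auto_def Let_def)
  have arrD: "\<exists>F \<alpha> G. f = Arrow F \<alpha> G \<and> F \<in> Obj ?C \<and> G \<in> Obj ?C \<and> is_nat_trans ?I D F G \<alpha> \<and>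
      (\<forall>x\<in>Obj ?O. \<alpha> x = Ident D (ObjMap F x)) \<and>
      (\<forall>x. \<alpha> x \<in> Hom D (ObjMap F x) (ObjMap G x))" if f_arr: "f \<in> Arr ?C" for f
  proof -
    obtain F \<alpha> G where f: "f = Arrow F \<alpha> G" "F \<in> Obj ?C" "G \<in> Obj ?C" "is_nat_trans ?I D F G \<alpha>"
      "whisker ?O (inclusion ?O) \<alpha> = id_nat_trans ?O D \<L>"
      using f_arr by (auto simp: Auto_def Let_def)
    then show ?thesis using whisk[OF obD(2)[OF f(2)]]
      by (auto simp: is_nat_trans_def Obj_I PiE_def)
  qed
  have arrI: "Arrow F \<alpha> G \<in> Arr ?C"
    if "F \<in> Obj ?C" "G \<in> Obj ?C" "is_nat_trans ?I D F G \<alpha>"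
      "\<forall>x\<in>Obj ?O. \<alpha> x = Ident D (ObjMap F x)" for F \<alpha> G
    using that whisk[OF obD(2)[OF that(1)]] by (auto simp: Auto_def Let_def)
  have simps: "Dom ?C = src" "Cod ?C = tgt"
    "\<And>F. Ident ?C F = Arrow F (id_nat_trans ?I D F) F"
    "\<And>f g. Comp ?C f g = Arrow (src f) (\<lambda>x. Comp D (body f x) (body g x)) (tgt g)"
    by (simp_all add: Auto_def Let_def Obj_I restrict_def)
  show ?thesis
    unfolding is_category_def
  proof (intro conjI ballI impI)
    fix F assume F: "F \<in> Obj ?C"
    show "Ident ?C F \<in> Hom ?C F F"
      using arrI[OF F F nat_id[OF obD(1)[OF F]]]
      by (auto simp: Hom_def simps id_nat_trans_def Obj_I)
  next
    fix f assume f: "f \<in> Arr ?C"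
    show "Dom ?C f \<in> Obj ?C" "Cod ?C f \<in> Obj ?C"
      using arrD[OF f] by (auto simp: simps)
    obtain F \<alpha> G where fe: "f = Arrow F \<alpha> G"
      and hom: "\<And>x. \<alpha> x \<in> Hom D (ObjMap F x) (ObjMap G x)"
      using arrD[OF f] by blast
    show "Comp ?C (Ident ?C (Dom ?C f)) f = f" "Comp ?C f (Ident ?C (Cod ?C f)) = f"
      by (simp_all add: fe simps id_nat_trans_def Obj_I id_l[OF hom] id_r[OF hom])
  next
    fix f g assume f: "f \<in> Arr ?C" and g: "g \<in> Arr ?C" and fg: "Cod ?C f = Dom ?C g"
    obtain F \<alpha> G where fe: "f = Arrow F \<alpha> G" "F \<in> Obj ?C" "G \<in> Obj ?C" "is_nat_trans ?I D F G \<alpha>"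
      "\<forall>x\<in>Obj ?O. \<alpha> x = Ident D (ObjMap F x)"
      using arrD[OF f] by blast
    obtain \<beta> H where ge: "g = Arrow G \<beta> H" "H \<in> Obj ?C" "is_nat_trans ?I D G H \<beta>"
      "\<forall>x\<in>Obj ?O. \<beta> x = Ident D (ObjMap G x)"
      using arrD[OF g] fg fe by (auto simp: simps)
    have FG: "ObjMap F x = ObjMap G x" if "x \<in> Obj ?O" for x
    proof -
      have "ObjMap (functor_comp ?O (inclusion ?O) F) x = ObjMap (functor_comp ?O (inclusion ?O) G) x"
        using obD(2)[OF fe(2)] obD(2)[OF fe(3)] by simp
      then show ?thesis using that by (simp add: functor_comp_def inclusion_def)
    qed
    have "\<forall>x\<in>Obj ?O. Comp D (\<alpha> x) (\<beta> x) = Ident D (ObjMap F x)"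
      using fe(5) ge(4) FG id_l[OF id_in[OF F_ob[OF obD(1)[OF fe(3)]]]] by auto
    then show "Comp ?C f g \<in> Hom ?C (Dom ?C f) (Cod ?C g)"
      using arrI[OF fe(2) ge(2) nat_comp[OF obD(1)[OF fe(2)] obD(1)[OF fe(3)] obD(1)[OF ge(2)] fe(4) ge(3)]]
      by (auto simp: simps fe(1) ge(1) Hom_def)
  next
    fix f g h
    assume f: "f \<in> Arr ?C" and g: "g \<in> Arr ?C" and h: "h \<in> Arr ?C"
      and fg: "Cod ?C f = Dom ?C g" and gh: "Cod ?C g = Dom ?C h"
    show "Comp ?C (Comp ?C f g) h = Comp ?C f (Comp ?C g h)"
    proof -
      obtain F \<alpha> G where fe: "f = Arrow F \<alpha> G"
        and a: "\<And>x. \<alpha> x \<in> Hom D (ObjMap F x) (ObjMap G x)"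
        using arrD[OF f] by blast
      obtain \<beta> H where ge: "g = Arrow G \<beta> H"
        and b: "\<And>x. \<beta> x \<in> Hom D (ObjMap G x) (ObjMap H x)"
        using arrD[OF g] fg fe by (auto simp: simps)
      obtain \<gamma> K where he: "h = Arrow H \<gamma> K"
        and c: "\<And>x. \<gamma> x \<in> Hom D (ObjMap H x) (ObjMap K x)"
        using arrD[OF h] gh ge by (auto simp: simps)
      show ?thesis by (simp add: simps fe ge he assoc[OF a b c])
    qed
  qed
qed

lemma word_arrow_inj: "word_arrow w = word_arrow w' \<longleftrightarrow> w = w'"
  by (auto simp: word_arrow_def inj_def dest: map_injective)

lemma word_path_to_In: "is_path (word_gens A) gen_src gen_tgt x p In \<Longrightarrow> p = [] \<and> x = In"
proof (induction p arbitrary: x)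
  case (Cons e p)
  then have "gen_tgt e = In" by (metis is_path.simps(2))
  then show ?case by (cases e) auto
qed simp

lemma word_path_from_Out:
  assumes "is_path (word_gens A) gen_src gen_tgt Out p y"
  shows "p = [] \<and> y = Out"
proof (cases p)
  case (Cons e q)
  then have "gen_src e = Out" using assms by simp
  then show ?thesis by (cases e) auto
qed (use assms in simp)

lemma word_path_States_Out:
  "is_path (word_gens A) gen_src gen_tgt States p Out \<Longrightarrow> \<exists>w\<in>lists A. p = map Letter w @ [Finish]"
proof (induction p)
  case (Cons e p)
  show ?case
  proof (cases e)
    case Start
    then show ?thesis using Cons.prems by simp
  next
    case (Letter a)
    then have a: "a \<in> A" and "is_path (word_gens A) gen_src gen_tgt States p Out"
      using Cons.prems by (auto simp: word_gens_def)
    with Cons.IH obtain w where "w \<in> lists A" "p = map Letter w @ [Finish]" by blast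
    with a Letter show ?thesis by (intro bexI[where x = "a # w"]) simp_all
  next
    case Finish
    then have "is_path (word_gens A) gen_src gen_tgt Out p Out" using Cons.prems by simp
    then have "p = []" using word_path_from_Out by blast
    with Finish show ?thesis by (intro bexI[where x = "[]"]) simp_all
  qed
qed simp

lemma word_path_Letters:
  "w \<in> lists A \<Longrightarrow> is_path (word_gens A) gen_src gen_tgt States (map Letter w @ [Finish]) Out"
  by (induction w) (auto simp: word_gens_def)

lemma Arr_O_word:
  "Arr (O_word A) = {Arrow In [] In, Arrow Out [] Out} \<union> word_arrow ` lists A"
proof
  show "Arr (O_word A) \<subseteq> {Arrow In [] In, Arrow Out [] Out} \<union> word_arrow ` lists A"
  proof
    fix f assume "f \<in> Arr (O_word A)"
    then obtain x p y where f: "f = Arrow x p y" "x \<in> {In, Out}" "y \<in> {In, Out}"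
      and p: "is_path (word_gens A) gen_src gen_tgt x p y"
      by (auto simp: O_word_def full_subcategory_def I_word_def free_category_def)
    consider "y = In" | "x = Out" | "x = In" "y = Out" using f by auto
    then show "f \<in> {Arrow In [] In, Arrow Out [] Out} \<union> word_arrow ` lists A"
    proof cases
      case 1
      then show ?thesis using f p word_path_to_In[of A x p] by simp
    next
      case 2
      then show ?thesis using f p word_path_from_Out[of A p y] by simp
    next
      case 3
      with p obtain e q where q: "p = e # q" "gen_src e = In"
        "is_path (word_gens A) gen_src gen_tgt (gen_tgt e) q Out"
        by (cases p) auto
      from q(2) have e: "e = Start" by (cases e) auto
      with q(3) obtain w where "w \<in> lists A" "q = map Letter w @ [Finish]"
        using word_path_States_Out[of A q] by auto
      then have "f = word_arrow w" using f(1) 3 q(1) e by (simp add: word_arrow_def)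
      then show ?thesis using \<open>w \<in> lists A\<close> by blast
    qed
  qed
  have "is_path (word_gens A) gen_src gen_tgt In (Start # map Letter w @ [Finish]) Out"
    if "w \<in> lists A" for w
    using word_path_Letters[OF that] by (simp add: word_gens_def)
  then have "word_arrow w \<in> Arr (O_word A)" if "w \<in> lists A" for w
    unfolding O_word_def full_subcategory_def I_word_def free_category_def word_arrow_def
    using that by simp
  moreover have "Arrow x [] x \<in> Arr (O_word A)" if "x \<in> {In, Out}" for x
    unfolding O_word_def full_subcategory_def I_word_def free_category_def using that by simp
  ultimately show "{Arrow In [] In, Arrow Out [] Out} \<union> word_arrow ` lists A \<subseteq> Arr (O_word A)"
    by blast
qed

lemma to_T1_in: "L \<in> word_funs A B \<Longrightarrow> to_T1 (L w) \<in> T_obj B One"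
  by (cases "L w") (auto simp: word_funs_def ran_def to_T1_def T_obj_def One_def)

lemma is_functor_language:
  assumes "L \<in> word_funs A B"
  shows "is_functor (O_word A) (Kl B) (language A B L ::
    (word_obj, 'a word_arrow, ('a, 'b, 'x) elem set, ('b, ('a, 'b, 'x) elem) kl_arrow) funct)"
proof -
  let ?F = "language A B L ::
    (word_obj, 'a word_arrow, ('a, 'b, 'x) elem set, ('b, ('a, 'b, 'x) elem) kl_arrow) funct"
  let ?M = "\<lambda>w. Arrow One (\<lambda>z\<in>One. to_T1 (L w)) One :: ('b, ('a, 'b, 'x) elem) kl_arrow"
  have obj: "Obj (O_word A) = {In, Out}"
    by (simp add: O_word_def full_subcategory_def I_word_def free_category_def)
  have arr: "ArrMap ?F (word_arrow w) = ?M w" if "\<forall>a\<in>set w. a \<in> A" for w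
    using that by (auto simp: language_def Arr_O_word word_arrow_inj)
  have ident: "ArrMap ?F (Arrow x [] x) = Ident (Kl B) One"
    if "x \<in> {In, Out}" for x
    using that by (auto simp: language_def Arr_O_word word_arrow_def)
  have K: "is_category (Kl B :: (('a, 'b, 'x) elem set, ('b, ('a, 'b, 'x) elem) kl_arrow) category)" by (rule is_category_Kl)
  have M: "?M w \<in> Arr (Kl B)" for w using to_T1_in[OF assms] by (auto simp: Kl_def)
  have I: "Ident (Kl B) (One :: ('a, 'b, 'x) elem set) \<in> Arr (Kl B)"
    by (auto simp: Kl_def T_unit_def T_obj_def)
  have dc: "Dom (Kl B) (?M w) = One" "Cod (Kl B) (?M w) = One"
    "Dom (Kl B) (Ident (Kl B) (One :: ('a, 'b, 'x) elem set)) = One" "Cod (Kl B) (Ident (Kl B) (One :: ('a, 'b, 'x) elem set)) = One" for w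
    by (simp_all add: Kl_def)
  have comp: "Comp (Kl B) (Ident (Kl B) One) (?M w) = ?M w"
    "Comp (Kl B) (?M w) (Ident (Kl B) One) = ?M w"
    "Comp (Kl B) (Ident (Kl B) One) (Ident (Kl B) One) = Ident (Kl B) (One :: ('a, 'b, 'x) elem set)" for w
    using category_ident[OF K M[of w]] category_ident[OF K I] by (simp_all only: dc)
  have O: "Dom (O_word A) = src" "Cod (O_word A) = tgt" "\<And>x. Ident (O_word A) x = Arrow x [] x"
    "\<And>f g. Comp (O_word A) f g = Arrow (src f) (body f @ body g) (tgt g)"
    by (simp_all add: O_word_def full_subcategory_def I_word_def free_category_def)
  have wa: "src (word_arrow w) = In" "tgt (word_arrow w) = Out"
    "Arrow In (body (word_arrow w)) Out = word_arrow w" for w :: "'a list"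
    by (simp_all add: word_arrow_def)
  have om: "ObjMap ?F \<in> Obj (O_word A) \<rightarrow>\<^sub>E Obj (Kl B)"
    by (auto simp: language_def Kl_def)
  have ov: "ObjMap ?F x = One" if "x \<in> {In, Out}" for x
    using that by (simp add: language_def obj)
  have am: "ArrMap ?F \<in> Arr (O_word A) \<rightarrow>\<^sub>E Arr (Kl B)"
  proof (rule PiE_I)
    show "ArrMap ?F f \<in> Arr (Kl B)" if "f \<in> Arr (O_word A)" for f
      using that arr ident M I by (auto simp: Arr_O_word)
  qed (simp add: language_def)
  show ?thesis
    unfolding is_functor_def
  proof (intro conjI ballI impI om am)
    fix f assume "f \<in> Arr (O_word A)"
    then show "Dom (Kl B) (ArrMap ?F f) = ObjMap ?F (Dom (O_word A) f)"
      "Cod (Kl B) (ArrMap ?F f) = ObjMap ?F (Cod (O_word A) f)"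
      by (auto simp: Arr_O_word O wa ov arr ident dc)
  next
    fix x assume "x \<in> Obj (O_word A)"
    then show "ArrMap ?F (Ident (O_word A) x) = Ident (Kl B) (ObjMap ?F x)"
      by (auto simp: obj O ov ident)
  next
    fix f g assume "f \<in> Arr (O_word A)" "g \<in> Arr (O_word A)" "Cod (O_word A) f = Dom (O_word A) g"
    then show "ArrMap ?F (Comp (O_word A) f g) =
      Comp (Kl B) (ArrMap ?F f) (ArrMap ?F g)"
      by (auto simp: Arr_O_word O wa arr ident comp)
  qed
qed

end

theory Submission
  imports Defs
begin

text \<open>Every \<open>K \<noteq> \<kappa>\<^sub>\<bottom>\<close> factors uniquely as a word \<open>lcp K\<close> followed by an irreducible
  function \<open>red K\<close>, so \<open>\<T>(Irr(A\<^sup>*, B\<^sup>*))\<close> is in bijection with \<open>(B\<^sup>* + 1)\<^sup>A\<^sup>*\<close>: the map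
  \<^term>\<open>lcp_red\<close> is inverse to the action of \<open>B\<^sup>*\<close> by prepending. Naturality with respect to the
  arrows \<open>w\<triangleleft>\<close> forces a morphism into the final automaton to send a state \<open>x\<close> to the element of
  \<open>\<T>(Irr(A\<^sup>*, B\<^sup>*))\<close> that corresponds to the function computed from \<open>x\<close>; conversely this
  assignment is natural, because \<^term>\<open>lcp_red\<close> is compatible with the Kleisli extension.\<close>

section \<open>Functors on free categories\<close>

lemma Comp_in_Hom:
  assumes "is_category C" "f \<in> Hom C x y" "g \<in> Hom C y z"
  shows "Comp C f g \<in> Hom C x z"
  using assms unfolding is_category_def Hom_def mem_Collect_eq by simp

lemma Comp_assoc_Hom:
  assumes "is_category C" "f \<in> Hom C w x" "g \<in> Hom C x y" "h \<in> Hom C y z"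
  shows "Comp C (Comp C f g) h = Comp C f (Comp C g h)"
  using assms unfolding is_category_def Hom_def mem_Collect_eq by simp

lemma Comp_Ident_Hom:
  assumes "is_category C" "f \<in> Hom C x y"
  shows "Comp C (Ident C x) f = f" "Comp C f (Ident C y) = f"
  using assms unfolding is_category_def Hom_def by auto

lemma Ident_in_Hom: "is_category C \<Longrightarrow> x \<in> Obj C \<Longrightarrow> Ident C x \<in> Hom C x x"
  unfolding is_category_def by blast

lemma free_category_simps:
  "Obj (free_category V E s t) = V"
  "Arrow x p y \<in> Arr (free_category V E s t) \<longleftrightarrow> x \<in> V \<and> y \<in> V \<and> is_path E s t x p y"
  "Dom (free_category V E s t) = src" "Cod (free_category V E s t) = tgt"
  "Ident (free_category V E s t) x = Arrow x [] x"
  "Comp (free_category V E s t) f g = Arrow (src f) (body f @ body g) (tgt g)"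
  by (simp_all add: free_category_def)

lemma path_ext_in_Hom:
  assumes "is_category D" "\<forall>x\<in>V. fo x \<in> Obj D"
    and "\<forall>e\<in>E. fe e \<in> Hom D (fo (s e)) (fo (t e))"
    and "y \<in> V" "is_path E s t x p y"
  shows "path_ext t D fo fe x p \<in> Hom D (fo x) (fo y)"
  using assms(5)
proof (induction p arbitrary: x)
  case Nil
  then show ?case using assms by (simp add: Ident_in_Hom)
next
  case (Cons e p)
  then show ?case using assms(1,3) by (auto intro: Comp_in_Hom)
qed

text \<open>Induction on \<open>p\<close>. The empty path contributes an identity and a further edge
  is absorbed by associativity. Both category laws hold only for composable arrows, so
  \<open>path_ext_in_Hom\<close> supplies the types.\<close>

lemma path_ext_append:
  assumes "is_category D" "\<forall>x\<in>V. fo x \<in> Obj D"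
    and "\<forall>e\<in>E. fe e \<in> Hom D (fo (s e)) (fo (t e))"
    and "y \<in> V" "z \<in> V" "is_path E s t x p y" "is_path E s t y q z"
  shows "path_ext t D fo fe x (p @ q) = Comp D (path_ext t D fo fe x p) (path_ext t D fo fe y q)"
  using assms(6)
proof (induction p arbitrary: x)
  case Nil
  then show ?case
    using Comp_Ident_Hom(1)[OF assms(1) path_ext_in_Hom[OF assms(1-3,5,7)]] by simp
next
  case (Cons e p)
  then have e: "e \<in> E" "s e = x" and p: "is_path E s t (t e) p y" by auto
  show ?case
    using Comp_assoc_Hom[OF assms(1) bspec[OF assms(3) e(1)]
        path_ext_in_Hom[OF assms(1-4) p] path_ext_in_Hom[OF assms(1-3,5,7)]]
      Cons.IH[OF p] by simp
qed

lemma is_functor_free_extension: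
  assumes "is_category D" "\<forall>x\<in>V. fo x \<in> Obj D"
    and "\<forall>e\<in>E. fe e \<in> Hom D (fo (s e)) (fo (t e))"
  shows "is_functor (free_category V E s t) D (free_extension V E s t D fo fe)"
proof -
  let ?C = "free_category V E s t" and ?F = "free_extension V E s t D fo fe"
  have V: "src f \<in> V" "tgt f \<in> V" "is_path E s t (src f) (body f) (tgt f)" if "f \<in> Arr ?C" for f
    using that by (cases f; simp add: free_category_simps)+
  have hom: "path_ext t D fo fe (src f) (body f) \<in> Hom D (fo (src f)) (fo (tgt f))"
    if "f \<in> Arr ?C" for f
    by (rule path_ext_in_Hom[OF assms V(2,3)[OF that]])
  show ?thesis
    unfolding is_functor_def
  proof (intro conjI ballI impI)
    fix f g assume f: "f \<in> Arr ?C" and g: "g \<in> Arr ?C" and fg: "Cod ?C f = Dom ?C g"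
    obtain x p y where fe: "f = Arrow x p y" by (cases f)
    with fg obtain q z where ge: "g = Arrow y q z" by (cases g) (auto simp: free_category_simps)
    show "ArrMap ?F (Comp ?C f g) = Comp D (ArrMap ?F f) (ArrMap ?F g)"
      using f g path_ext_append[OF assms, of y z x p q]
      by (auto simp: fe ge free_category_simps free_extension_def is_path_append)
  qed (use hom V assms(2) in \<open>auto simp: free_extension_def free_category_simps Hom_def\<close>)
qed

lemma functor_in_Hom:
  assumes "is_functor C D F" "f \<in> Arr C"
  shows "ArrMap F f \<in> Hom D (ObjMap F (Dom C f)) (ObjMap F (Cod C f))"
  using assms by (auto simp: is_functor_def Hom_def)

text \<open>Splits the first generator off a path. Later this separates the initial arrow, or the
  first letter read, from the rest of a word.\<close>

lemma functor_free_category_Cons: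
  assumes "is_functor (free_category V E s t) D F"
    and "s e \<in> V" "t e \<in> V" "y \<in> V" "e \<in> E" "is_path E s t (t e) p y"
  shows "ArrMap F (Arrow (s e) (e # p) y) =
    Comp D (ArrMap F (Arrow (s e) [e] (t e))) (ArrMap F (Arrow (t e) p y))"
proof -
  have "Arrow (s e) [e] (t e) \<in> Arr (free_category V E s t)"
    "Arrow (t e) p y \<in> Arr (free_category V E s t)"
    using assms by (auto simp: free_category_simps)
  then have "ArrMap F (Comp (free_category V E s t) (Arrow (s e) [e] (t e)) (Arrow (t e) p y)) =
    Comp D (ArrMap F (Arrow (s e) [e] (t e))) (ArrMap F (Arrow (t e) p y))"
    using assms(1) unfolding is_functor_def by (simp add: free_category_simps(3,4))
  then show ?thesis by (simp add: free_category_simps)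
qed

text \<open>In a free category naturality needs checking on generators only: the squares of the
  edges of a path paste together, by induction on the path.\<close>

lemma is_nat_trans_free_category:
  assumes D: "is_category D"
    and V: "s ` E \<subseteq> V" "t ` E \<subseteq> V"
    and F: "is_functor (free_category V E s t) D F"
    and G: "is_functor (free_category V E s t) D G"
    and \<alpha>: "\<alpha> \<in> (\<Pi>\<^sub>E x\<in>V. Hom D (ObjMap F x) (ObjMap G x))"
    and nat: "\<And>e. e \<in> E \<Longrightarrow> Comp D (ArrMap F (Arrow (s e) [e] (t e))) (\<alpha> (t e)) =
      Comp D (\<alpha> (s e)) (ArrMap G (Arrow (s e) [e] (t e)))"
  shows "is_nat_trans (free_category V E s t) D F G \<alpha>"
proof -
  let ?C = "free_category V E s t"
  have hom: "ArrMap H (Arrow x p y) \<in> Hom D (ObjMap H x) (ObjMap H y)"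
    if "is_functor ?C D H" "x \<in> V" "y \<in> V" "is_path E s t x p y" for H x p y
    using functor_in_Hom[OF that(1), of "Arrow x p y"] that(2-) by (simp add: free_category_simps)
  have ident: "ArrMap H (Arrow x [] x) = Ident D (ObjMap H x)"
    if "is_functor ?C D H" "x \<in> V" for H x
    using that by (simp add: is_functor_def free_category_simps)
  have \<alpha>': "\<alpha> x \<in> Hom D (ObjMap F x) (ObjMap G x)" if "x \<in> V" for x
    using \<alpha> that by auto
  have "Comp D (ArrMap F (Arrow x p y)) (\<alpha> y) = Comp D (\<alpha> x) (ArrMap G (Arrow x p y))"
    if "x \<in> V" "y \<in> V" "is_path E s t x p y" for x p y
    using that
  proof (induction p arbitrary: x)
    case Nil
    then show ?case
      using Comp_Ident_Hom[OF D \<alpha>'[of y]] by (simp add: ident[OF F] ident[OF G])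
  next
    case (Cons e p)
    then have e: "e \<in> E" "x = s e" "s e \<in> V" "t e \<in> V" and p: "is_path E s t (t e) p y"
      using V by auto
    have ep: "is_path E s t (s e) [e] (t e)" using e by simp
    note Fe = hom[OF F e(3,4) ep] and Ge = hom[OF G e(3,4) ep]
      and Fp = hom[OF F e(4) \<open>y \<in> V\<close> p] and Gp = hom[OF G e(4) \<open>y \<in> V\<close> p]
    have "Comp D (ArrMap F (Arrow x (e # p) y)) (\<alpha> y) =
        Comp D (ArrMap F (Arrow (s e) [e] (t e))) (Comp D (\<alpha> (t e)) (ArrMap G (Arrow (t e) p y)))"
      using functor_free_category_Cons[of V E s t D F e y p, OF F e(3,4) \<open>y \<in> V\<close> e(1) p]
        Comp_assoc_Hom[OF D Fe Fp \<alpha>'[OF \<open>y \<in> V\<close>]] Cons.IH[OF e(4) \<open>y \<in> V\<close> p]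
      by (simp add: e(2))
    also have "\<dots> = Comp D (Comp D (\<alpha> (s e)) (ArrMap G (Arrow (s e) [e] (t e))))
        (ArrMap G (Arrow (t e) p y))"
      using Comp_assoc_Hom[OF D Fe \<alpha>'[OF e(4)] Gp] nat[OF e(1)] by simp
    also have "\<dots> = Comp D (\<alpha> x) (ArrMap G (Arrow x (e # p) y))"
      using functor_free_category_Cons[of V E s t D G e y p, OF G e(3,4) \<open>y \<in> V\<close> e(1) p]
        Comp_assoc_Hom[OF D \<alpha>'[OF e(3)] Ge Gp] by (simp add: e(2))
    finally show ?case .
  qed
  then show ?thesis
    using \<alpha> by (auto simp: is_nat_trans_def free_category_def)
qed

section \<open>The action of words on partial functions\<close>

text \<open>The left action of the monoid of output words on partial functions. It keeps undefined
  values undefined.\<close>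

definition shift :: "'b list \<Rightarrow> ('a list \<rightharpoonup> 'b list) \<Rightarrow> ('a list \<rightharpoonup> 'b list)" where
  "shift w K = (\<lambda>u. map_option ((@) w) (K u))"

text \<open>Partial functions form an algebra for the monad, with structure map given by
  \<open>shift\<close> and \<bottom> sent to the empty function. \<open>act h\<close> is the
  extension of \<open>h\<close> to the free algebra on the domain of \<open>h\<close>. For
  \<open>h = the_fun\<close> on irreducible states it will be the inverse of
  \<open>lcp_red\<close>.\<close>

definition act :: "('u \<Rightarrow> ('a list \<rightharpoonup> 'b list)) \<Rightarrow> ('b list \<times> 'u) option \<Rightarrow> ('a list \<rightharpoonup> 'b list)" where
  "act h m = (case m of None \<Rightarrow> Map.empty | Some (w, x) \<Rightarrow> shift w (h x))"

lemma act_simps [simp]: "act h None = Map.empty" "act h (Some (w, x)) = shift w (h x)"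
  by (simp_all add: act_def)

lemma shift_Nil [simp]: "shift [] K = K"
proof
  show "shift [] K u = K u" for u by (cases "K u") (simp_all add: shift_def)
qed

lemma shift_eq_empty_iff [simp]: "shift w K = Map.empty \<longleftrightarrow> K = Map.empty"
  by (auto simp: shift_def fun_eq_iff)

lemma ran_shift: "ran (shift w K) = (@) w ` ran K"
  by (auto simp: shift_def ran_def)

lemma ran_eq_empty_iff: "ran K = {} \<longleftrightarrow> K = Map.empty"
  by (auto simp: ran_def fun_eq_iff) (metis option.exhaust)

section \<open>Longest common prefixes and reductions under the action of words\<close>

text \<open>Induction on \<open>w\<close>, moving one letter out at a time. Nonemptiness matters,
  since every word is a common prefix of the empty set and no longest one exists.\<close>

lemma Longest_common_prefix_append:
  assumes "X \<noteq> {}"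
  shows "Longest_common_prefix ((@) w ` X) = w @ Longest_common_prefix X"
proof (induction w)
  case (Cons b w)
  have "(@) (b # w) ` X = (#) b ` (@) w ` X" by auto
  then show ?case using Longest_common_prefix_image_Cons[of "(@) w ` X" b] assms Cons by simp
qed simp

lemma lcp_shift: "K \<noteq> Map.empty \<Longrightarrow> lcp (shift w K) = w @ lcp K"
  by (simp add: lcp_def ran_shift Longest_common_prefix_append ran_eq_empty_iff)

text \<open>Left cancellation makes the suffix unique, so the \<open>THE\<close> in
  \<open>red\<close> is well defined.\<close>

lemma red_eq_Some_iff: "red K u = Some v \<longleftrightarrow> K u = Some (lcp K @ v)"
  by (auto simp: red_def)

lemma red_eqI: "(\<And>u v. K u = Some (lcp K @ v) \<longleftrightarrow> K' u = Some v) \<Longrightarrow> red K = K'"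
  by (metis ext not_Some_eq red_eq_Some_iff)

text \<open>Shifting by \<open>w\<close> lengthens the longest common prefix by exactly
  \<open>w\<close>, which then cancels against the prefix added to each value.\<close>

lemma red_shift: "K \<noteq> Map.empty \<Longrightarrow> red (shift w K) = red K"
  by (rule red_eqI) (simp add: lcp_shift red_eq_Some_iff, auto simp: shift_def)

text \<open>Every defined value of \<open>K\<close> begins with \<open>lcp K\<close>, so
  \<open>red\<close> discards no value. For the empty function both sides are empty, whatever
  \<open>lcp\<close> returns there.\<close>

lemma shift_lcp_red: "shift (lcp K) (red K) = K"
proof
  fix u
  show "shift (lcp K) (red K) u = K u"
  proof (cases "K u")
    case (Some y)
    then have "prefix (lcp K) y"
      unfolding lcp_def by (auto intro: Longest_common_prefix_prefix ranI)
    then obtain v where "y = lcp K @ v" by (auto simp: prefix_def)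
    then show ?thesis using Some red_eq_Some_iff[of K u v] by (simp add: shift_def)
  next
    case None
    then have "red K u = None" by (simp add: red_def)
    then show ?thesis using None by (simp add: shift_def)
  qed
qed

lemma lcp_red_irreducible: "K \<in> Irr A B \<Longrightarrow> lcp_red K = Some ([], Fun K)"
  by (auto simp: Irr_def lcp_red_def intro!: red_eqI)

lemma red_in_Irr:
  assumes "K \<in> word_funs A B" "K \<noteq> Map.empty"
  shows "lcp K \<in> lists B" "red K \<in> Irr A B"
proof -
  have ne: "red K \<noteq> Map.empty" using assms(2) shift_lcp_red[of K] by (metis shift_eq_empty_iff)
  obtain u y where y: "K u = Some y" using assms(2) by (auto simp: fun_eq_iff)
  have mem: "lcp K @ v \<in> lists B" if "red K u = Some v" for u v
    using that assms(1) ranI[of K u] unfolding red_eq_Some_iff word_funs_def by blast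
  \<comment> \<open>Computing the left side by \<open>lcp_shift\<close> gives
    \<open>lcp K @ lcp (red K)\<close>. Cancelling \<open>lcp K\<close> shows that
    \<open>red K\<close> is irreducible.\<close>
  have "lcp (shift (lcp K) (red K)) = lcp K" by (simp only: shift_lcp_red)
  then have "lcp (red K) = []" using lcp_shift[OF ne] by simp
  moreover have "dom (red K) \<subseteq> dom K" by (auto simp: red_eq_Some_iff)
  then have "dom (red K) \<subseteq> lists A" using assms(1) by (auto simp only: word_funs_def mem_Collect_eq)
  moreover have "ran (red K) \<subseteq> lists B"
    using mem by (auto simp: ran_def)
  ultimately show "red K \<in> Irr A B" using ne by (auto simp: Irr_def word_funs_def)
  \<comment> \<open>One defined value suffices: \<open>lcp K\<close> is a prefix of a word over
    \<open>B\<close>.\<close>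
  from ne obtain u v where "red K u = Some v" by (auto simp: fun_eq_iff)
  from mem[OF this] show "lcp K \<in> lists B" by simp
qed

lemma lcp_red_in: "K \<in> word_funs A B \<Longrightarrow> lcp_red K \<in> T_obj B (Irr_states A B)"
  using red_in_Irr[of K A B] by (auto simp: lcp_red_def T_obj_def Irr_states_def image_iff)

section \<open>The bijection between partial functions and the monad applied to irreducible
  states\<close>

lemma act_lcp_red: "act the_fun (lcp_red K) = K"
  by (simp add: lcp_red_def shift_lcp_red)

text \<open>\<open>lcp_red\<close> is a homomorphism of algebras: prepending \<open>w\<close> adds
  \<open>w\<close> to the longest common prefix and leaves the reduction unchanged, and the empty
  function goes to \<bottom>. Kleisli composition can therefore be computed on partial
  functions.\<close>

lemma T_mult_lcp_red: "T_mult (T_map (\<lambda>x. lcp_red (h x)) m) = lcp_red (act h m)"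
proof (cases m)
  case (Some p)
  obtain w x where "m = Some (w, x)" using Some by (cases p) auto
  then show ?thesis
    by (cases "h x = Map.empty") (auto simp: lcp_red_def T_map_def lcp_shift red_shift)
qed (simp add: T_map_def lcp_red_def)

text \<open>Evaluation at \<open>u\<close> is a homomorphism of algebras too, so running an
  automaton from the outcome \<open>m\<close> of a step evaluates \<open>act h m\<close>.\<close>

lemma T_mult_to_T1: "T_mult (T_map (\<lambda>x. to_T1 (h x u)) m) = to_T1 (act h m u)"
proof (cases m)
  case (Some p)
  obtain w x where "m = Some (w, x)" using Some by (cases p) auto
  then show ?thesis
    by (cases "h x u") (auto simp: T_map_def to_T1_def shift_def)
qed (simp add: T_map_def to_T1_def)

text \<open>The homomorphism property moves \<open>lcp_red\<close> inside, where on an irreducible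
  function it is the unit of the monad. A unit law finishes.\<close>

lemma lcp_red_act: "m \<in> T_obj B (Irr_states A B) \<Longrightarrow> lcp_red (act the_fun m) = m"
  by (auto simp: T_mult_lcp_red[symmetric] T_obj_def Irr_states_def T_map_def lcp_red_irreducible)

lemma T_map_cong: "m \<in> T_obj B X \<Longrightarrow> (\<And>x. x \<in> X \<Longrightarrow> g x = h x) \<Longrightarrow> T_map g m = T_map h m"
  by (auto simp: T_obj_def T_map_def)

text \<open>Bodies of Kleisli arrows are extensional. The restriction is invisible to
  \<open>m\<close>, whose state, if any, lies in \<open>X\<close>.\<close>

lemma T_mult_restrict: "m \<in> T_obj B X \<Longrightarrow> T_mult (T_map (restrict g X) m) = T_mult (T_map g m)"
  by (auto cong: T_map_cong)

lemma T_mult_restrict_lcp_red: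
  "K \<in> word_funs A B \<Longrightarrow>
   T_mult (T_map (restrict g (Irr_states A B)) (lcp_red K)) = T_mult (T_map g (lcp_red K))"
  by (rule T_mult_restrict) (rule lcp_red_in)

lemma restrict_eqD: "restrict f X = restrict g X \<Longrightarrow> x \<in> X \<Longrightarrow> f x = g x"
  by (metis restrict_apply')

lemma restrict_eq_iff: "restrict f X = restrict g X \<longleftrightarrow> (\<forall>x\<in>X. f x = g x)"
  using restrict_eqD by (fastforce intro: restrict_ext)

text \<open>Quotients act on the input and shifts on the output, so they commute.\<close>

lemma left_quotient_act: "left_quotient a (act h m) = act (\<lambda>x. left_quotient a (h x)) m"
  by (auto simp: act_def left_quotient_def shift_def split: option.split)

lemma shift_in_word_funs:
  assumes "w \<in> lists B" "K \<in> word_funs A B"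
  shows "shift w K \<in> word_funs A B"
proof -
  have "dom (shift w K) = dom K" by (auto simp: shift_def dom_def)
  moreover have "w @ v \<in> lists B" if "v \<in> ran K" for v
  proof -
    have "v \<in> lists B" using that assms(2) unfolding word_funs_def by blast
    then show ?thesis using assms(1) by simp
  qed
  ultimately show ?thesis
    using assms(2) unfolding word_funs_def by (simp add: ran_shift image_subset_iff)
qed

lemma act_in_word_funs:
  assumes "m \<in> T_obj B (Irr_states A B)"
  shows "act the_fun m \<in> word_funs A B"
proof (cases "m = None")
  case True
  then show ?thesis by (simp add: word_funs_def)
next
  case False
  then obtain w K where "m = Some (w, Fun K)" "w \<in> lists B" "K \<in> Irr A B"
    using assms unfolding T_obj_def Irr_states_def by blast
  then show ?thesis by (simp add: Irr_def shift_in_word_funs)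
qed

lemma left_quotient_in: "K \<in> word_funs A B \<Longrightarrow> left_quotient a K \<in> word_funs A B"
  by (fastforce simp: word_funs_def left_quotient_def dom_def ran_def)

lemma word_funs_outside: "K \<in> word_funs A B \<Longrightarrow> w \<notin> lists A \<Longrightarrow> K w = None"
  using domIff[of w K] unfolding word_funs_def by blast

lemma the_fun_in_word_funs: "q \<in> Irr_states A B \<Longrightarrow> the_fun q \<in> word_funs A B"
  by (auto simp: Irr_states_def Irr_def)

lemma inj_to_T1: "to_T1 v = to_T1 v' \<longleftrightarrow> v = v'"
  by (cases v; cases v'; simp add: to_T1_def)

section \<open>The final automaton\<close>

lemma Hom_Kl: "f \<in> Hom (Kl B) X Y \<longleftrightarrow> (\<exists>h \<in> X \<rightarrow>\<^sub>E T_obj B Y. f = Arrow X h Y)"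
  by (auto simp: Hom_def Kl_def)

lemma Comp_Kl:
  "Comp (Kl B) (Arrow X g Y) (Arrow Y h Z) = Arrow X (\<lambda>x\<in>X. T_mult (T_map h (g x))) Z"
  by (simp add: Kl_def)

lemma Ident_Kl: "Ident (Kl B) X = Arrow X (\<lambda>x\<in>X. T_unit x) X"
  by (simp add: Kl_def)

lemma final_gens_in_Hom:
  assumes "L \<in> word_funs A B"
  shows "final_gens A B L e \<in> Hom (Kl B) (final_objs A B (gen_src e)) (final_objs A B (gen_tgt e))"
proof (cases e)
  case Start
  then show ?thesis using assms by (auto simp: Hom_Kl lcp_red_in)
next
  case (Letter a)
  then show ?thesis
    by (auto simp: Hom_Kl intro: lcp_red_in left_quotient_in the_fun_in_word_funs)
next
  case Finish
  then show ?thesis by (auto simp: Hom_Kl intro: to_T1_in the_fun_in_word_funs)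
qed

text \<open>\<open>path_ext\<close> turns a single edge into a composite with an identity, and
  morphisms of automata are identities at \<open>In\<close> and \<open>Out\<close>. These rules
  remove such identities.\<close>

lemmas final_gens_Ident = Comp_Ident_Hom[OF is_category_Kl final_gens_in_Hom]

lemma is_functor_final_automaton:
  "L \<in> word_funs A B \<Longrightarrow> is_functor (I_word A) (Kl B) (final_automaton A B L)"
  unfolding I_word_def final_automaton_def
  by (rule is_functor_free_extension)
    (auto simp: is_category_Kl final_gens_in_Hom, simp add: Kl_def)

lemma final_automaton_ObjMap: "ObjMap (final_automaton A B L) = final_objs A B"
  by (auto simp: final_automaton_def free_extension_def)

lemma final_automaton_gen:
  assumes "L \<in> word_funs A B" "e \<in> word_gens A"
  shows "ArrMap (final_automaton A B L) (Arrow (gen_src e) [e] (gen_tgt e)) = final_gens A B L e"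
  using Comp_Ident_Hom(2)[OF is_category_Kl final_gens_in_Hom[OF assms(1), of e]] assms(2)
  by (simp add: final_automaton_def free_extension_def free_category_simps)

text \<open>In the final automaton the function computed from the state \<open>K\<close> is
  \<open>K\<close> itself. In the inductive step, reading \<open>a\<close> yields
  \<open>lcp_red\<close> of the quotient, which \<open>act_lcp_red\<close> reassembles; its value at
  \<open>w\<close> is that of \<open>K\<close> at \<open>a # w\<close>.\<close>

lemma path_ext_final_gens:
  assumes "L \<in> word_funs A B" "w \<in> lists A"
  shows "path_ext gen_tgt (Kl B) (final_objs A B) (final_gens A B L) States
      (map Letter w @ [Finish]) =
    Arrow (Irr_states A B) (\<lambda>q\<in>Irr_states A B. to_T1 (the_fun q w))
      (One :: ('a, 'b, 'x) elem set)"
  using assms(2)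
proof (induction w)
  case Nil
  show ?case
    by (simp add: final_gens_Ident(2)[OF assms(1), of Finish, simplified] del: restrict_apply)
next
  case (Cons a w)
  let ?Q = "Irr_states A B :: ('a, 'b, 'x) elem set"
  have "T_mult (T_map (\<lambda>q\<in>?Q. to_T1 (the_fun q w)) (lcp_red (left_quotient a (the_fun q)))) =
      (to_T1 (the_fun q (a # w)) :: ('b list \<times> ('a, 'b, 'x) elem) option)"
    if "q \<in> ?Q" for q
    using that
    by (simp add: T_mult_restrict_lcp_red left_quotient_in the_fun_in_word_funs
        T_mult_to_T1 act_lcp_red) (simp add: left_quotient_def)
  then show ?case using Cons by (simp add: Comp_Kl restrict_apply' del: restrict_apply cong: restrict_cong)
qed

lemma final_automaton_word:
  assumes "L \<in> word_funs A B" "w \<in> lists A"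
  shows "ArrMap (final_automaton A B L) (Arrow States (map Letter w @ [Finish]) Out) =
    Arrow (Irr_states A B) (\<lambda>q\<in>Irr_states A B. to_T1 (the_fun q w)) One"
  using path_ext_final_gens[OF assms] word_path_Letters[OF assms(2)]
  by (simp add: final_automaton_def free_extension_def free_category_simps)

section \<open>Automata accepting the language\<close>

lemma functor_Start_word:
  assumes "is_functor (I_word A) D F" "w \<in> lists A"
  shows "ArrMap F (word_arrow w) = Comp D (ArrMap F (Arrow In [Start] States))
    (ArrMap F (Arrow States (map Letter w @ [Finish]) Out))"
  using functor_free_category_Cons[of UNIV "word_gens A" gen_src gen_tgt D F Start Out]
    assms word_path_Letters[OF assms(2)]
  by (simp add: word_arrow_def I_word_def word_gens_def)

lemma functor_Letter_word:
  assumes "is_functor (I_word A) D F" "a \<in> A" "w \<in> lists A"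
  shows "ArrMap F (Arrow States (map Letter (a # w) @ [Finish]) Out) =
    Comp D (ArrMap F (Arrow States [Letter a] States))
    (ArrMap F (Arrow States (map Letter w @ [Finish]) Out))"
  using functor_free_category_Cons[of UNIV "word_gens A" gen_src gen_tgt D F "Letter a" Out]
    assms word_path_Letters[OF assms(3)]
  by (simp add: I_word_def word_gens_def)

lemma Obj_O_word: "Obj (O_word A) = {In, Out}"
  by (simp add: O_word_def full_subcategory_def I_word_def free_category_def)

lemma language_simps:
  "w \<in> lists A \<Longrightarrow> ArrMap (language A B L) (word_arrow w) = Arrow One (\<lambda>z\<in>One. to_T1 (L w)) One"
  "x \<in> {In, Out} \<Longrightarrow> ArrMap (language A B L) (Arrow x [] x) = Ident (Kl B) One"
  "x \<in> {In, Out} \<Longrightarrow> ObjMap (language A B L) x = One"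
proof -
  show "w \<in> lists A \<Longrightarrow>
      ArrMap (language A B L) (word_arrow w) = Arrow One (\<lambda>z\<in>One. to_T1 (L w)) One"
    by (simp add: language_def Arr_O_word word_arrow_inj)
  show "x \<in> {In, Out} \<Longrightarrow> ArrMap (language A B L) (Arrow x [] x) = Ident (Kl B) One"
    by (auto simp: language_def Arr_O_word word_arrow_def)
qed (simp add: language_def Obj_O_word)

text \<open>By \<open>Arr_O_word\<close> the arrows of \<open>O_word A\<close> are two identities
  and the word arrows. A functor handles the identities automatically, so acceptance is a condition
  on words.\<close>

lemma in_Obj_Auto_iff:
  "F \<in> Obj (Auto A (Kl B) (language A B L)) \<longleftrightarrow>
     is_functor (I_word A) (Kl B) F \<and> ObjMap F In = One \<and> ObjMap F Out = One \<and>
     (\<forall>w\<in>lists A. ArrMap F (word_arrow w) = Arrow One (\<lambda>z\<in>One. to_T1 (L w)) One)"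
proof -
  have F_ident: "ArrMap F (Arrow x [] x) = Ident (Kl B) (ObjMap F x)"
    if "is_functor (I_word A) (Kl B) F" for x
    using that by (auto simp: is_functor_def I_word_def free_category_simps)
  have "functor_comp (O_word A) (inclusion (O_word A)) F = language A B L \<longleftrightarrow>
      (\<forall>x\<in>Obj (O_word A). ObjMap F x = ObjMap (language A B L) x) \<and>
      (\<forall>f\<in>Arr (O_word A). ArrMap F f = ArrMap (language A B L) f)"
    by (auto simp: functor_comp_def inclusion_def language_def fun_eq_iff)
  also have "\<dots> \<longleftrightarrow> ObjMap F In = One \<and> ObjMap F Out = One \<and>
      (\<forall>w\<in>lists A. ArrMap F (word_arrow w) = Arrow One (\<lambda>z\<in>One. to_T1 (L w)) One)"
    if "is_functor (I_word A) (Kl B) F"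
    using F_ident[OF that] by (auto simp: Obj_O_word Arr_O_word ball_Un language_simps)
  finally show ?thesis by (auto simp: Auto_def Let_def)
qed

lemma final_automaton_in_Auto:
  assumes "L \<in> word_funs A B"
  shows "(final_automaton A B L ::
      (word_obj, 'a word_arrow, ('a, 'b, 'x) elem set, ('b, ('a, 'b, 'x) elem) kl_arrow) funct)
    \<in> Obj (Auto A (Kl B) (language A B L))"
proof -
  let ?F = "final_automaton A B L ::
    (word_obj, 'a word_arrow, ('a, 'b, 'x) elem set, ('b, ('a, 'b, 'x) elem) kl_arrow) funct"
  have "ArrMap ?F (word_arrow w) = Arrow One (\<lambda>z\<in>One. to_T1 (L w)) One" if w: "w \<in> lists A" for w
  proof -
    have "ArrMap ?F (Arrow In [Start] States) = Arrow One (\<lambda>z\<in>One. lcp_red L) (Irr_states A B)"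
      using final_automaton_gen[OF assms, of Start] by (simp add: word_gens_def)
    then show ?thesis
      by (simp add: functor_Start_word[OF is_functor_final_automaton[OF assms] w]
          final_automaton_word[OF assms w] Comp_Kl T_mult_restrict_lcp_red[OF assms] T_mult_to_T1 act_lcp_red cong: restrict_cong)
  qed
  moreover have "ObjMap ?F In = One" "ObjMap ?F Out = One"
    by (simp_all add: final_automaton_def free_extension_def)
  ultimately show ?thesis by (simp add: in_Obj_Auto_iff is_functor_final_automaton[OF assms])
qed

section \<open>The function computed from a state of an arbitrary automaton\<close>

text \<open>\<open>fst\<close> inverts \<open>to_T1\<close>. The default \<open>None\<close> off the
  words over \<open>A\<close>, where the path is not an arrow and \<open>ArrMap\<close> carries no
  information, puts the result in \<open>word_funs\<close>.\<close>

definition behaviour ::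
    "'a set \<Rightarrow> (word_obj, 'a word_arrow, 'u set, ('b, 'u) kl_arrow) funct \<Rightarrow> 'u \<Rightarrow> ('a list \<rightharpoonup> 'b list)" where
  "behaviour A F x = (\<lambda>w. if w \<in> lists A
     then map_option fst (body (ArrMap F (Arrow States (map Letter w @ [Finish]) Out)) x) else None)"

lemma T_obj_One: "m \<in> T_obj B One \<Longrightarrow> to_T1 (map_option fst m) = m"
  by (auto simp: T_obj_def One_def to_T1_def)

text \<open>The components at \<open>In\<close> and \<open>Out\<close> are forced to be identities
  by the whiskering condition on morphisms of automata.\<close>

definition to_final ::
    "'a set \<Rightarrow> 'b set \<Rightarrow>
     (word_obj, 'a word_arrow, ('a, 'b, 'x) elem set, ('b, ('a, 'b, 'x) elem) kl_arrow) funct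
     \<Rightarrow> word_obj \<Rightarrow> ('b, ('a, 'b, 'x) elem) kl_arrow" where
  "to_final A B F x = (if x = States
     then Arrow (ObjMap F States) (\<lambda>q\<in>ObjMap F States. lcp_red (behaviour A F q)) (Irr_states A B)
     else Ident (Kl B) One)"

context
  fixes A :: "'a set" and B :: "'b set" and L :: "'a list \<rightharpoonup> 'b list"
    and F :: "(word_obj, 'a word_arrow, ('a, 'b, 'x) elem set, ('b, ('a, 'b, 'x) elem) kl_arrow) funct"
  assumes L: "L \<in> word_funs A B"
    and F: "F \<in> Obj (Auto A (Kl B) (language A B L))"
begin

lemma accepting_functor: "is_functor (I_word A) (Kl B) F"
  and accepting_In: "ObjMap F In = One" and accepting_Out: "ObjMap F Out = One"
  and accepting_word: "w \<in> lists A \<Longrightarrow> ArrMap F (word_arrow w) = Arrow One (\<lambda>z\<in>One. to_T1 (L w)) One"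
  using F by (auto simp: in_Obj_Auto_iff)

lemma accepting_path:
  assumes "w \<in> lists A"
  shows "ArrMap F (Arrow States (map Letter w @ [Finish]) Out) =
    Arrow (ObjMap F States) (\<lambda>x\<in>ObjMap F States. to_T1 (behaviour A F x w)) One"
    and "x \<in> ObjMap F States \<Longrightarrow> to_T1 (behaviour A F x w) \<in> T_obj B (One :: ('a, 'b, 'x) elem set)"
proof -
  have "Arrow States (map Letter w @ [Finish]) Out \<in> Arr (I_word A)"
    using word_path_Letters[OF assms] by (simp add: I_word_def free_category_simps)
  from functor_in_Hom[OF accepting_functor this]
  obtain h where h: "h \<in> ObjMap F States \<rightarrow>\<^sub>E T_obj B One"
    "ArrMap F (Arrow States (map Letter w @ [Finish]) Out) = Arrow (ObjMap F States) h One"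
    by (auto simp: I_word_def free_category_simps Hom_Kl accepting_Out)
  have beh: "to_T1 (behaviour A F x w) = h x" if "x \<in> ObjMap F States" for x
    using that h T_obj_One[of "h x" B] assms by (auto simp: behaviour_def)
  then show "x \<in> ObjMap F States \<Longrightarrow> to_T1 (behaviour A F x w) \<in> T_obj B (One :: ('a, 'b, 'x) elem set)"
    using h(1) by auto
  have "h = (\<lambda>x\<in>ObjMap F States. to_T1 (behaviour A F x w))"
    using h(1) beh by (intro ext) (auto simp: PiE_def extensional_def)
  then show "ArrMap F (Arrow States (map Letter w @ [Finish]) Out) =
    Arrow (ObjMap F States) (\<lambda>x\<in>ObjMap F States. to_T1 (behaviour A F x w)) One"
    using h(2) by simp
qed

lemma behaviour_in:
  assumes "x \<in> ObjMap F States"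
  shows "behaviour A F x \<in> word_funs A B"
proof -
  have "v \<in> lists B" if "behaviour A F x w = Some v" for w v
  proof -
    have "w \<in> lists A" using that by (auto simp: behaviour_def split: if_splits)
    from accepting_path(2)[OF this assms] show ?thesis
      using that by (auto simp: to_T1_def T_obj_def)
  qed
  moreover have "w \<in> lists A" if "behaviour A F x w = Some v" for w v
    using that by (auto simp: behaviour_def split: if_splits)
  ultimately show ?thesis
    unfolding word_funs_def ran_def dom_def by blast
qed

lemma accepting_gen:
  assumes "e \<in> word_gens A"
  obtains h where
    "ArrMap F (Arrow (gen_src e) [e] (gen_tgt e)) =
      Arrow (ObjMap F (gen_src e)) h (ObjMap F (gen_tgt e))"
    "h \<in> ObjMap F (gen_src e) \<rightarrow>\<^sub>E T_obj B (ObjMap F (gen_tgt e))"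
  using functor_in_Hom[OF accepting_functor, of "Arrow (gen_src e) [e] (gen_tgt e)"] assms that
  by (auto simp: I_word_def free_category_simps Hom_Kl)

lemma act_behaviour_outside: "w \<notin> lists A \<Longrightarrow> act (behaviour A F) m w = None"
  by (auto simp: act_def shift_def behaviour_def split: option.split)

text \<open>The arrow of \<open>w\<close> from \<open>In\<close> to \<open>Out\<close> is
  \<open>Start\<close> followed by the path of \<open>w\<close> from \<open>States\<close> to
  \<open>Out\<close>, and its value is known because the automaton accepts \<open>L\<close>.
  \<open>T_mult_to_T1\<close> reads the composite as an evaluation of \<open>act\<close>.\<close>

lemma behaviour_Start:
  assumes "ArrMap F (Arrow In [Start] States) = Arrow One h (ObjMap F States)"
    and "h \<in> One \<rightarrow>\<^sub>E T_obj B (ObjMap F States)" and "z \<in> One"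
  shows "act (behaviour A F) (h z) = L"
proof
  fix w
  show "act (behaviour A F) (h z) w = L w"
  proof (cases "w \<in> lists A")
    case True
    have hz: "h z \<in> T_obj B (ObjMap F States)" using assms by auto
    have "(\<lambda>z\<in>One. T_mult (T_map
        (\<lambda>x\<in>ObjMap F States. to_T1 (behaviour A F x w)) (h z))) =
        (\<lambda>z\<in>One. to_T1 (L w) :: ('b list \<times> ('a, 'b, 'x) elem) option)"
      using accepting_word[OF True] functor_Start_word[OF accepting_functor True]
      by (simp add: assms(1) accepting_path(1)[OF True] Comp_Kl)
    from restrict_eqD[OF this assms(3)] show ?thesis
      by (simp add: T_mult_restrict[OF hz] T_mult_to_T1 inj_to_T1)
  next
    case False
    then show ?thesis by (simp only: act_behaviour_outside[OF False] word_funs_outside[OF L False])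
  qed
qed

text \<open>The path of \<open>a # w\<close> to \<open>Out\<close> is the letter \<open>a\<close>
  followed by the path of \<open>w\<close>, so the outcome of reading \<open>a\<close> computes the
  quotient by \<open>a\<close>.\<close>

lemma behaviour_Letter:
  assumes "a \<in> A"
    and "ArrMap F (Arrow States [Letter a] States) = Arrow (ObjMap F States) h (ObjMap F States)"
    and "h \<in> ObjMap F States \<rightarrow>\<^sub>E T_obj B (ObjMap F States)" and x: "x \<in> ObjMap F States"
  shows "act (behaviour A F) (h x) = left_quotient a (behaviour A F x)"
proof
  fix w
  show "act (behaviour A F) (h x) w = left_quotient a (behaviour A F x) w"
  proof (cases "w \<in> lists A")
    case True
    then have aw: "a # w \<in> lists A" using assms(1) by simp
    have hx: "h x \<in> T_obj B (ObjMap F States)" using assms by auto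
    have "(\<lambda>y\<in>ObjMap F States. T_mult (T_map
        (\<lambda>x\<in>ObjMap F States. to_T1 (behaviour A F x w)) (h y))) =
        (\<lambda>y\<in>ObjMap F States. to_T1 (behaviour A F y (a # w))
          :: ('b list \<times> ('a, 'b, 'x) elem) option)"
      using functor_Letter_word[OF accepting_functor assms(1) True]
      by (simp only: assms(2) accepting_path(1)[OF True] accepting_path(1)[OF aw] Comp_Kl arrow.inject)
    from restrict_eqD[OF this x] show ?thesis
      by (simp add: T_mult_restrict[OF hx] T_mult_to_T1 inj_to_T1 left_quotient_def)
  next
    case False
    then show ?thesis by (auto simp: act_behaviour_outside left_quotient_def behaviour_def)
  qed
qed

lemma behaviour_Finish:
  "ArrMap F (Arrow States [Finish] Out) =
    Arrow (ObjMap F States) (\<lambda>x\<in>ObjMap F States. to_T1 (behaviour A F x [])) One"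
  using accepting_path(1)[of "[]"] by simp

section \<open>Existence and uniqueness of the morphism to the final automaton\<close>

lemma to_final_in_Hom: "to_final A B F x \<in> Hom (Kl B) (ObjMap F x) (final_objs A B x)"
proof (cases x)
  case States
  then show ?thesis by (auto simp: to_final_def Hom_Kl behaviour_in lcp_red_in)
qed (auto simp: to_final_def accepting_In accepting_Out Hom_Kl Ident_Kl T_unit_def T_obj_def)

lemma T_mult_to_final:
  "m \<in> T_obj B X \<Longrightarrow>
   T_mult (T_map (\<lambda>q\<in>X. lcp_red (behaviour A F q)) m) = lcp_red (act (behaviour A F) m)"
  by (simp add: T_mult_restrict T_mult_lcp_red)

text \<open>At each generator both sides reduce to the same value: \<open>lcp_red L\<close> for
  \<open>Start\<close>, \<open>lcp_red\<close> of the quotient of the behaviour for a letter, and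
  the behaviour at the empty word for \<open>Finish\<close>.\<close>

lemma to_final_natural:
  assumes e: "e \<in> word_gens A"
  shows "Comp (Kl B) (ArrMap F (Arrow (gen_src e) [e] (gen_tgt e))) (to_final A B F (gen_tgt e)) =
    Comp (Kl B) (to_final A B F (gen_src e)) (final_gens A B L e)"
proof -
  obtain h where h: "ArrMap F (Arrow (gen_src e) [e] (gen_tgt e)) =
      Arrow (ObjMap F (gen_src e)) h (ObjMap F (gen_tgt e))"
    "h \<in> ObjMap F (gen_src e) \<rightarrow>\<^sub>E T_obj B (ObjMap F (gen_tgt e))"
    using accepting_gen[OF e] .
  let ?Q = "ObjMap F States" and ?I = "Irr_states A B :: ('a, 'b, 'x) elem set"
  show ?thesis
  proof (cases e)
    case Start
    have "Comp (Kl B) (ArrMap F (Arrow (gen_src e) [e] (gen_tgt e))) (to_final A B F (gen_tgt e)) =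
        Arrow One (\<lambda>z\<in>One. T_mult (T_map (\<lambda>q\<in>?Q. lcp_red (behaviour A F q)) (h z))) ?I"
      using h(1) Start by (simp add: accepting_In to_final_def Comp_Kl)
    also have "(\<lambda>z\<in>One. T_mult (T_map (\<lambda>q\<in>?Q. lcp_red (behaviour A F q)) (h z))) =
        (\<lambda>z\<in>One. lcp_red L)"
    proof (rule restrict_ext)
      fix z :: "('a, 'b, 'x) elem" assume z: "z \<in> One"
      then have "h z \<in> T_obj B ?Q" using h(2) Start by (auto simp: accepting_In)
      then show "T_mult (T_map (\<lambda>q\<in>?Q. lcp_red (behaviour A F q)) (h z)) = lcp_red L"
        using behaviour_Start[of h z] h z Start by (simp add: T_mult_to_final accepting_In)
    qed
    also have "Arrow One (\<lambda>z\<in>One. lcp_red L) ?I =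
        Comp (Kl B) (to_final A B F (gen_src e)) (final_gens A B L e)"
      using Start by (simp add: to_final_def final_gens_Ident(1)[OF L, of Start, simplified])
    finally show ?thesis .
  next
    case (Letter a)
    then have a: "a \<in> A" using e by (auto simp: word_gens_def)
    have "T_mult (T_map (\<lambda>q\<in>?Q. lcp_red (behaviour A F q)) (h x)) =
        (T_mult (T_map (\<lambda>q\<in>?I. lcp_red (left_quotient a (the_fun q))) (lcp_red (behaviour A F x))) ::
          ('b list \<times> ('a, 'b, 'x) elem) option)"
      if x: "x \<in> ?Q" for x
    proof -
      have "h x \<in> T_obj B ?Q" using h(2) Letter x by auto
      then have "T_mult (T_map (\<lambda>q\<in>?Q. lcp_red (behaviour A F q)) (h x)) =
          lcp_red (left_quotient a (behaviour A F x))"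
        using behaviour_Letter[OF a, of h x] h x Letter by (simp add: T_mult_to_final)
      \<comment> \<open>Read from right to left: \<open>T_mult_lcp_red\<close> pulls
        \<open>lcp_red\<close> out, \<open>left_quotient_act\<close> pulls the quotient out, and
        \<open>act_lcp_red\<close> recovers the behaviour.\<close>
      also have "\<dots> =
          T_mult (T_map (\<lambda>q\<in>?I. lcp_red (left_quotient a (the_fun q))) (lcp_red (behaviour A F x)))"
        by (simp add: T_mult_restrict_lcp_red behaviour_in x T_mult_lcp_red
            left_quotient_act[symmetric] act_lcp_red)
      finally show ?thesis .
    qed
    then show ?thesis using h(1) Letter by (simp add: to_final_def Comp_Kl cong: restrict_cong)
  next
    case Finish
    have "T_mult (T_map (\<lambda>q\<in>?I. to_T1 (the_fun q [])) (lcp_red (behaviour A F x))) =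
        (to_T1 (behaviour A F x []) :: ('b list \<times> ('a, 'b, 'x) elem) option)" if x: "x \<in> ?Q" for x
      by (simp add: T_mult_restrict_lcp_red behaviour_in x T_mult_to_T1 act_lcp_red)
    then have "Comp (Kl B) (to_final A B F (gen_src e)) (final_gens A B L e) =
        Arrow ?Q (\<lambda>x\<in>?Q. to_T1 (behaviour A F x [])) One"
      using Finish by (simp add: to_final_def Comp_Kl cong: restrict_cong)
    moreover have "ArrMap F (Arrow States [Finish] Out) \<in> Hom (Kl B) ?Q One"
      using h Finish by (auto simp: Hom_Kl accepting_Out)
    ultimately show ?thesis
      using Finish Comp_Ident_Hom(2)[OF is_category_Kl] behaviour_Finish
      by (simp add: to_final_def)
  qed
qed

lemma nat_trans_to_final:
  "is_nat_trans (I_word A) (Kl B) F (final_automaton A B L) (to_final A B F)"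
  unfolding I_word_def
proof (rule is_nat_trans_free_category[OF is_category_Kl])
  show "to_final A B F \<in> (\<Pi>\<^sub>E x\<in>UNIV. Hom (Kl B) (ObjMap F x) (ObjMap (final_automaton A B L) x))"
    using to_final_in_Hom by (auto simp: final_automaton_ObjMap)
qed (use accepting_functor is_functor_final_automaton[OF L] in
    \<open>auto simp: I_word_def to_final_natural final_automaton_gen[OF L]\<close>)

lemma nat_trans_unique:
  assumes \<alpha>: "is_nat_trans (I_word A) (Kl B) F (final_automaton A B L) \<alpha>"
    and ends: "\<alpha> In = Ident (Kl B) One" "\<alpha> Out = Ident (Kl B) One"
  shows "\<alpha> = to_final A B F"
proof -
  let ?Q = "ObjMap F States" and ?I = "Irr_states A B :: ('a, 'b, 'x) elem set"
  have "\<alpha> States \<in> Hom (Kl B) ?Q ?I"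
    using \<alpha> by (auto simp: is_nat_trans_def I_word_def free_category_simps final_automaton_ObjMap
        dest: PiE_mem[of _ _ _ States])
  then obtain h where h: "h \<in> ?Q \<rightarrow>\<^sub>E T_obj B ?I" "\<alpha> States = Arrow ?Q h ?I"
    by (auto simp: Hom_Kl)
  have h_eq: "h x = lcp_red (behaviour A F x)" if x: "x \<in> ?Q" for x
  proof -
    have hx: "h x \<in> T_obj B ?I" using h(1) x by auto
    \<comment> \<open>Naturality at the path of \<open>w\<close> to \<open>Out\<close>. Since
      \<alpha> is the identity at \<open>Out\<close>, one side is the output of \<open>F\<close>,
      while the other runs the final automaton from \<open>h x\<close>.\<close>
    have "act the_fun (h x) w = behaviour A F x w" if w: "w \<in> lists A" for w
    proof -
      let ?p = "Arrow States (map Letter w @ [Finish]) Out"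
      have p: "?p \<in> Arr (I_word A)"
        using word_path_Letters[OF w] by (simp add: I_word_def free_category_simps)
      then have "ArrMap F ?p \<in> Hom (Kl B) ?Q One"
        using functor_in_Hom[OF accepting_functor p] by (simp add: I_word_def free_category_simps accepting_Out)
      then have "Comp (Kl B) (ArrMap F ?p) (\<alpha> Out) = ArrMap F ?p"
        using Comp_Ident_Hom(2)[OF is_category_Kl] ends(2) by simp
      moreover have "Comp (Kl B) (ArrMap F ?p) (\<alpha> Out) =
          Comp (Kl B) (\<alpha> States) (ArrMap (final_automaton A B L) ?p)"
        using \<alpha> p by (auto simp: is_nat_trans_def I_word_def free_category_simps(3,4))
      ultimately have "(\<lambda>x\<in>?Q. T_mult (T_map (\<lambda>q\<in>?I. to_T1 (the_fun q w)) (h x))) =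
          (\<lambda>x\<in>?Q. to_T1 (behaviour A F x w) :: ('b list \<times> ('a, 'b, 'x) elem) option)"
        by (simp add: accepting_path(1)[OF w] final_automaton_word[OF L w] h(2) Comp_Kl)
      from restrict_eqD[OF this x] show ?thesis
        by (simp add: T_mult_restrict[OF hx] T_mult_to_T1 inj_to_T1)
    qed
    \<comment> \<open>Equality of functions also concerns lists that are not words over
      \<open>A\<close>; both sides are \<open>None\<close> there.\<close>
    moreover have "act the_fun (h x) w = behaviour A F x w" if "w \<notin> lists A" for w
      by (simp only: word_funs_outside[OF act_in_word_funs[OF hx] that]
          word_funs_outside[OF behaviour_in[OF x] that])
    ultimately have "act the_fun (h x) = behaviour A F x" by blast
    \<comment> \<open>Applying \<open>lcp_red\<close> to both sides recovers \<open>h x\<close>,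
      because it inverts \<open>act the_fun\<close>.\<close>
    then show ?thesis using lcp_red_act[OF hx] by simp
  qed
  then have "h = (\<lambda>x\<in>?Q. lcp_red (behaviour A F x))"
    using h(1) by (intro ext) (auto simp: PiE_def extensional_def)
  then have "\<alpha> x = to_final A B F x" for x
    using h(2) ends by (cases x) (simp_all add: to_final_def)
  then show ?thesis by blast
qed

end

theorem lemma4p7:
  fixes A :: "'a set" and B :: "'b set" and L :: "'a list \<rightharpoonup> 'b list"
  assumes "L \<in> word_funs A B"
  shows "final_object
           (Auto A (Kl B :: (('a, 'b, 'x) elem set, ('b, ('a, 'b, 'x) elem) kl_arrow) category)
              (language A B L))
           (final_automaton A B L)"
proof -
  let ?K = "Kl B :: (('a, 'b, 'x) elem set, ('b, ('a, 'b, 'x) elem) kl_arrow) category"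
  let ?C = "Auto A ?K (language A B L)"
  let ?T = "final_automaton A B L ::
    (word_obj, 'a word_arrow, ('a, 'b, 'x) elem set, ('b, ('a, 'b, 'x) elem) kl_arrow) funct"
  have T: "?T \<in> Obj ?C" by (rule final_automaton_in_Auto[OF assms])
  \<comment> \<open>Whiskering with the inclusion sees only the components at \<open>In\<close> and
    \<open>Out\<close>, so the component at \<open>States\<close> is left for naturality to
    determine.\<close>
  have whisk: "whisker (O_word A) (inclusion (O_word A)) \<alpha> =
      id_nat_trans (O_word A) ?K (language A B L) \<longleftrightarrow>
      \<alpha> In = Ident ?K One \<and> \<alpha> Out = Ident ?K One" for \<alpha>
    unfolding whisker_def id_nat_trans_def restrict_eq_iff
    by (simp add: inclusion_def Obj_O_word language_simps)
  have hom: "f \<in> Hom ?C F ?T \<longleftrightarrow> (\<exists>\<alpha>. f = Arrow F \<alpha> ?T \<and>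
      is_nat_trans (I_word A) ?K F ?T \<alpha> \<and> \<alpha> In = Ident ?K One \<and> \<alpha> Out = Ident ?K One)"
    if "F \<in> Obj ?C" for f F
    using that T unfolding Auto_def Let_def Hom_def by (auto simp: whisk)
  have "\<exists>!f. f \<in> Hom ?C F ?T" if F: "F \<in> Obj ?C" for F
  proof (rule ex1I)
    show "Arrow F (to_final A B F) ?T \<in> Hom ?C F ?T"
      using nat_trans_to_final[OF assms F] by (auto simp: hom[OF F] to_final_def)
    show "f = Arrow F (to_final A B F) ?T" if "f \<in> Hom ?C F ?T" for f
      using that nat_trans_unique[OF assms F] by (auto simp: hom[OF F])
  qed
  with T show ?thesis by (simp add: final_object_def)
qed

end
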